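(* Let $n,k\in\mathbb{N}$, $U\subset\mathbb{R}^{n+k}$ open, $t_1<t_2$ real, $(V_t)_{t\in[t_1,t_2]}$ a family in $\mathbf{V}_n(U)$, $\mathscr{B}:\mathbf{V}_n(U)\times C_c^2(U)\times\{f:U\to\mathbb{R}^{n+k}\}\to[-\infty,\infty)$ a Brakke variation, and $u_t:U\to\mathbb{R}^{n+k}$ for $t\in[t_1,t_2]$. Suppose that at least one of the following holds: (a) $\sup_{t\in[t_1,t_2]}\|u_t\|_{L^\infty((K,\|V_t\|),\mathbb{R}^{n+k})}<\infty$ for all $K\subset\subset U$; (b) $\sup_{t\in[t_1,t_2]}\|u_t\|_{L^2((K,\|V_t\|),\mathbb{R}^{n+k})}<\infty$ for all $K\subset\subset U$. Suppose moreover that (B1) holds: for all $s\in[t_1,t_2]$ and $\phi\in C_c^2(U,\mathbb{R}^+)$, $\overline{\partial}_t\|V_t\|(\phi)|_{t=s}\le\mathscr{B}(V_s,\phi,u_s)$. Then for all $s\in[t_1,t_2]$ and all $\phi\in C^1([t_1,t_2],C_c^1(U))$ we have $$\overline{\partial}_t\|V_t\|(\phi_t)|_{t=s}\le\overline{\partial}_t\|V_t\|(\phi_s)|_{t=s}+\limsup_{\delta\to0}\|V_{s+\delta}\|(\partial_t\phi_t|_{t=s}).$$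
   Context: Notation. $\mathbb{N}=\{1,2,\dots\}$, $\mathbb{R}^+=[0,\infty)$. $\mathbf{G}(n+k,n)$ is the space of $n$-dimensional linear subspaces $S$ of $\mathbb{R}^{n+k}$; $S_\natural$ is the orthogonal projection onto $S$ (also regarded as a matrix), $S^\perp$ the orthogonal complement and $S^\perp_\natural$ the orthogonal projection onto it. For square matrices $A\cdot B=\mathrm{trace}(A^TB)$. $\mathbf{G}_n(U)=U\times\mathbf{G}(n+k,n)$; $\mathbf{V}_n(U)$ is the set of Radon measures on $\mathbf{G}_n(U)$ (varifolds). For $V\in\mathbf{V}_n(U)$, $\|V\|$ is the Radon measure on $U$ with $\|V\|(A)=V(\{(x,S):x\in A\})$, and $\|V\|(\phi)=\int\phi\,d\|V\|$. $K\subset\subset U$ means the closure of $K$ is a compact subset of $U$. $\phi\in C^1([t_1,t_2],C_c^1(U))$ means: $\phi_t\in C_c^1(U)$ (real-valued) for all $t$, all $\phi_t$ have support in a common compact subset of $U$, and $t\mapsto\phi_t$ is continuously differentiable with respect to the $C^1$-norm; $\partial_t\phi_t|_{t=s}$ is its derivative. For $f:I\to\mathbb{R}$ on an interval $I$ and $s\in I$: $\overline{\partial}_tf(t)|_{t=s}=\limsup_{t\to s,\,t\in I}\frac{f(t)-f(s)}{t-s}\in[-\infty,\infty]$. Limits $\delta\to0$ are over $\delta\neq0$ with $s+\delta\in[t_1,t_2]$. Mean curvature. For $V\in\mathbf{V}_n(U)$ and $\Omega\subset U$ open, $\mathbf{H}\in L^1_{\mathrm{loc}}((\Omega,\|V\|),\mathbb{R}^{n+k})$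 is the generalised mean curvature vector of $V$ in $\Omega$ if $\int D\Psi(x)\cdot S_\natural\,dV(x,S)=-\int\Psi\cdot\mathbf{H}\,d\|V\|$ for all $\Psi\in C_c^1(\Omega,\mathbb{R}^{n+k})$. Brakke variation. $\mathscr{B}$ is called a Brakke variation if for all $V\in\mathbf{V}_n(U)$, $\phi\in C_c^2(U,\mathbb{R}^+)$, $f:U\to\mathbb{R}^{n+k}$: if $V$ has a generalised mean curvature vector $\mathbf{H}$ in $\{\phi>0\}$ and $f,\mathbf{H}$ are square integrable on $\{\phi>0\}$ with respect to $\|V\|$, then $$\mathscr{B}(V,\phi,f)\le\int_{\mathbf{G}_n(U)}\big(S^\perp_\natural D\phi(x)-\phi(x)\mathbf{H}(x)\big)\cdot\big(\mathbf{H}(x)+S^\perp_\natural f(x)\big)\,dV(x,S),$$ and otherwise $\mathscr{B}(V,\phi,f)=-\infty$. *)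

theory Defs
  imports "HOL-Analysis.Analysis"
begin

text \<open>
  The ambient space R^{n+k} is \<open>real ^ 'm\<close> with \<open>CARD('m) = n + k\<close>.
  Functions on an open set \<open>U\<close> are total functions; for compactly supported ones this is
  extension by zero, for the others the values outside \<open>U\<close> play no role.
\<close>

subsection \<open>Test functions\<close>

definition cont_diff1 :: "('a::real_normed_vector \<Rightarrow> 'b::real_normed_vector) \<Rightarrow> bool" where
  "cont_diff1 f \<longleftrightarrow> (\<exists>D :: 'a \<Rightarrow> 'a \<Rightarrow>\<^sub>L 'b.
     (\<forall>x. (f has_derivative blinfun_apply (D x)) (at x)) \<and> continuous_on UNIV D)"

definition cont_diff2 :: "('a::real_normed_vector \<Rightarrow> 'b::real_normed_vector) \<Rightarrow> bool" where
  "cont_diff2 f \<longleftrightarrow> (\<exists>D :: 'a \<Rightarrow> 'a \<Rightarrow>\<^sub>L 'b.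
     (\<forall>x. (f has_derivative blinfun_apply (D x)) (at x)) \<and> cont_diff1 D)"

definition supp :: "('a::topological_space \<Rightarrow> 'b::zero) \<Rightarrow> 'a set" where
  "supp f = closure {x. f x \<noteq> 0}"

definition Cc1 :: "'a::real_normed_vector set \<Rightarrow> ('a \<Rightarrow> 'b::real_normed_vector) set" where
  "Cc1 U = {f. cont_diff1 f \<and> compact (supp f) \<and> supp f \<subseteq> U}"

definition Cc2 :: "'a::real_normed_vector set \<Rightarrow> ('a \<Rightarrow> 'b::real_normed_vector) set" where
  "Cc2 U = {f. cont_diff2 f \<and> compact (supp f) \<and> supp f \<subseteq> U}"

definition gradient :: "('a::real_inner \<Rightarrow> real) \<Rightarrow> 'a \<Rightarrow> 'a" where
  "gradient f x = (THE D. GDERIV f x :> D)"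

text \<open>The suprema are finite for the functions it is applied to, members of \<open>Cc1 U\<close>.\<close>

definition C1_norm :: "('a::real_inner \<Rightarrow> real) \<Rightarrow> real" where
  "C1_norm f = (SUP x. \<bar>f x\<bar>) + (SUP x. norm (gradient f x))"

definition has_Cc1_time_derivative ::
  "(real \<Rightarrow> 'a::real_inner \<Rightarrow> real) \<Rightarrow> ('a \<Rightarrow> real) \<Rightarrow> real set \<Rightarrow> 'a set \<Rightarrow> real \<Rightarrow> bool" where
  "has_Cc1_time_derivative \<phi> \<psi> I U s \<longleftrightarrow> \<psi> \<in> Cc1 U \<and>
     ((\<lambda>t. C1_norm (\<lambda>x. (\<phi> t x - \<phi> s x) / (t - s) - \<psi> x)) \<longlongrightarrow> 0) (at s within I)"

definition time_derivative ::
  "(real \<Rightarrow> 'a::real_inner \<Rightarrow> real) \<Rightarrow> real set \<Rightarrow> 'a set \<Rightarrow> real \<Rightarrow> 'a \<Rightarrow> real" where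
  "time_derivative \<phi> I U s = (THE \<psi>. has_Cc1_time_derivative \<phi> \<psi> I U s)"

text \<open>The space \<open>C\<^sup>1(I, C\<^sub>c\<^sup>1(U))\<close>.\<close>

definition C1_Cc1 :: "real set \<Rightarrow> 'a::real_inner set \<Rightarrow> (real \<Rightarrow> 'a \<Rightarrow> real) set" where
  "C1_Cc1 I U = {\<phi>. (\<forall>t\<in>I. \<phi> t \<in> Cc1 U) \<and>
     (\<exists>K. compact K \<and> K \<subseteq> U \<and> (\<forall>t\<in>I. supp (\<phi> t) \<subseteq> K)) \<and>
     (\<exists>\<psi>. (\<forall>s\<in>I. has_Cc1_time_derivative \<phi> (\<psi> s) I U s) \<and>
          (\<forall>s\<in>I. ((\<lambda>t. C1_norm (\<lambda>x. \<psi> t x - \<psi> s x)) \<longlongrightarrow> 0) (at s within I)))}"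

subsection \<open>Upper derivative\<close>

definition upper_deriv :: "(real \<Rightarrow> real) \<Rightarrow> real set \<Rightarrow> real \<Rightarrow> ereal" where
  "upper_deriv f I s = Limsup (at s within I) (\<lambda>t. ereal ((f t - f s) / (t - s)))"

subsection \<open>Radon measures and varifolds\<close>

definition grassmannian :: "nat \<Rightarrow> (real ^ 'm) set set" where
  "grassmannian n = {S. subspace S \<and> dim S = n}"

definition orth_proj :: "(real ^ 'm) set \<Rightarrow> real ^ 'm \<Rightarrow> real ^ 'm" where
  "orth_proj S x = (THE y. y \<in> S \<and> x - y \<in> S\<^sup>\<bottom>)"

text \<open>The standard topology, induced by identifying a subspace with the matrix of its
  orthogonal projection.\<close>

definition grassmannian_topology :: "nat \<Rightarrow> (real ^ 'm) set topology" where
  "grassmannian_topology n =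
     pullback_topology (grassmannian n) (\<lambda>S. matrix (orth_proj S)) euclidean"

definition Gr_bundle :: "nat \<Rightarrow> (real ^ 'm) set \<Rightarrow> ((real ^ 'm) \<times> (real ^ 'm) set) topology" where
  "Gr_bundle n U = prod_topology (top_of_set U) (grassmannian_topology n)"

text \<open>A Radon measure is represented by its restriction to the Borel sets; in the outer-measure
  setting it is recovered from this by Borel regularity. Inner regularity is automatic on the
  space \<open>Gr_bundle n U\<close> (for open \<open>U\<close>).\<close>

definition radon_measure :: "'a topology \<Rightarrow> 'a measure \<Rightarrow> bool" where
  "radon_measure X M \<longleftrightarrow>
     space M = topspace X \<and> sets M = sigma_sets (topspace X) {W. openin X W} \<and>
     (\<forall>K. compactin X K \<longrightarrow> emeasure M K < \<infinity>) \<and>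
     (\<forall>A\<in>sets M. emeasure M A = (SUP K\<in>{K. compactin X K \<and> K \<subseteq> A}. emeasure M K))"

definition varifolds ::
  "nat \<Rightarrow> (real ^ 'm) set \<Rightarrow> ((real ^ 'm) \<times> (real ^ 'm) set) measure set" where
  "varifolds n U = {V. radon_measure (Gr_bundle n U) V}"

definition weight ::
  "(real ^ 'm) set \<Rightarrow> ((real ^ 'm) \<times> (real ^ 'm) set) measure \<Rightarrow> (real ^ 'm) measure" where
  "weight U V = distr V (restrict_space borel U) fst"

subsection \<open>Lebesgue spaces\<close>

text \<open>Functions such as mean curvature vectors are only measurable with respect to the
  completed measure, so the notions below are applied to completions.\<close>

definition square_integrable_on ::
  "'a measure \<Rightarrow> 'a set \<Rightarrow> ('a \<Rightarrow> 'b::euclidean_space) \<Rightarrow> bool" where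
  "square_integrable_on M A f \<longleftrightarrow>
     set_borel_measurable M A f \<and> set_integrable M A (\<lambda>x. (norm (f x))\<^sup>2)"

definition L2_norm_on :: "'a measure \<Rightarrow> 'a set \<Rightarrow> ('a \<Rightarrow> 'b::euclidean_space) \<Rightarrow> ereal" where
  "L2_norm_on M A f =
     (if square_integrable_on M A f then ereal (sqrt (LINT x:A|M. (norm (f x))\<^sup>2)) else \<infinity>)"

definition Linf_norm_on :: "'a measure \<Rightarrow> 'a set \<Rightarrow> ('a \<Rightarrow> 'b::euclidean_space) \<Rightarrow> ereal" where
  "Linf_norm_on M A f =
     (if set_borel_measurable M A f
      then Inf {ereal C | C. 0 \<le> C \<and> (AE x in M. x \<in> A \<longrightarrow> norm (f x) \<le> C)} else \<infinity>)"

definition compactly_contained :: "'a::topological_space set \<Rightarrow> 'a set \<Rightarrow> bool" where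
  "compactly_contained K U \<longleftrightarrow> compact (closure K) \<and> closure K \<subseteq> U"

subsection \<open>Generalised mean curvature and Brakke variations\<close>

definition gen_mean_curvature ::
  "(real ^ 'm) set \<Rightarrow> ((real ^ 'm) \<times> (real ^ 'm) set) measure \<Rightarrow> (real ^ 'm) set
    \<Rightarrow> (real ^ 'm \<Rightarrow> real ^ 'm) \<Rightarrow> bool" where
  "gen_mean_curvature U V \<Omega> H \<longleftrightarrow>
     (\<forall>K. compact K \<and> K \<subseteq> \<Omega> \<longrightarrow> set_integrable (completion (weight U V)) K H) \<and>
     (\<forall>\<Psi> \<in> Cc1 \<Omega>.
        (LINT (x, S)|V. trace (transpose (jacobian \<Psi> (at x)) ** matrix (orth_proj S))) =
        - (LINT x|completion (weight U V). \<Psi> x \<bullet> H x))"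

text \<open>For nonnegative \<open>\<phi>\<close> the integrand vanishes off \<open>{\<phi> > 0}\<close>, so the values of \<open>H\<close> and \<open>f\<close>
  there are irrelevant.\<close>

definition brakke_integral ::
  "((real ^ 'm) \<times> (real ^ 'm) set) measure \<Rightarrow> (real ^ 'm \<Rightarrow> real)
    \<Rightarrow> (real ^ 'm \<Rightarrow> real ^ 'm) \<Rightarrow> (real ^ 'm \<Rightarrow> real ^ 'm) \<Rightarrow> real" where
  "brakke_integral V \<phi> f H =
     (LINT (x, S)|completion V.
        (orth_proj (S\<^sup>\<bottom>) (gradient \<phi> x) - \<phi> x *\<^sub>R H x) \<bullet> (H x + orth_proj (S\<^sup>\<bottom>) (f x)))"

definition brakke_admissible ::
  "(real ^ 'm) set \<Rightarrow> ((real ^ 'm) \<times> (real ^ 'm) set) measure \<Rightarrow> (real ^ 'm \<Rightarrow> real)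
    \<Rightarrow> (real ^ 'm \<Rightarrow> real ^ 'm) \<Rightarrow> (real ^ 'm \<Rightarrow> real ^ 'm) \<Rightarrow> bool" where
  "brakke_admissible U V \<phi> f H \<longleftrightarrow>
     gen_mean_curvature U V {x. \<phi> x > 0} H \<and>
     square_integrable_on (completion (weight U V)) {x. \<phi> x > 0} f \<and>
     square_integrable_on (completion (weight U V)) {x. \<phi> x > 0} H"

definition brakke_variation ::
  "nat \<Rightarrow> (real ^ 'm) set
    \<Rightarrow> (((real ^ 'm) \<times> (real ^ 'm) set) measure \<Rightarrow> (real ^ 'm \<Rightarrow> real)
        \<Rightarrow> (real ^ 'm \<Rightarrow> real ^ 'm) \<Rightarrow> ereal) \<Rightarrow> bool" where
  "brakke_variation n U \<B> \<longleftrightarrow>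
     (\<forall>V \<in> varifolds n U. \<forall>\<phi> \<in> Cc2 U. \<forall>f. (\<forall>x. 0 \<le> \<phi> x) \<longrightarrow>
        (\<forall>H. brakke_admissible U V \<phi> f H \<longrightarrow> \<B> V \<phi> f \<le> ereal (brakke_integral V \<phi> f H)) \<and>
        ((\<nexists>H. brakke_admissible U V \<phi> f H) \<longrightarrow> \<B> V \<phi> f = - \<infinity>))"

end

theory Submission
  imports Defs
begin

text \<open>
  Write \<open>\<mu> t\<close> for the weight of \<open>V t\<close>. The difference quotient of the integrals of \<open>\<phi> t\<close> is the quotient
  for the fixed function \<open>\<phi> s\<close>, plus the integral of the time derivative of \<open>\<phi>\<close> against \<open>\<mu> t\<close>, plus the
  integral of an error that tends to zero uniformly on a compact set. The inequality follows
  once the \<open>\<mu> t\<close>-mass of every compact set stays bounded for \<open>t\<close> near \<open>s\<close>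
  (\<open>time_dependent_upper_deriv_le\<close>). For \<open>t > s\<close> such a bound is immediate, because the upper derivative
  at \<open>s\<close> of the mass of a bump is not \<open>\<infinity>\<close>. For \<open>t < s\<close> it is the heart of the matter: mass
  might have come in from outside and vanished at time \<open>s\<close>.

  It is excluded by a barrier. On a ball of radius \<open>R\<close> around \<open>a\<close> in \<open>U\<close> let
  \<open>\<psi> = max 0 (r - |x - a|\<^sup>2)\<close> with \<open>r \<le> R\<^sup>2\<close>. Testing with \<open>\<psi>\<^sup>4\<close>, completing squares, and applying the
  first variation identity to the gradient of \<open>\<psi>\<^sup>4\<close> show that the Brakke variation is at most
  \<open>\<Lambda> \<integral>\<psi>\<^sup>3 d\<mu> + \<Lambda>\<close>, with \<open>\<Lambda>\<close> depending only on \<open>n\<close>, \<open>R\<close> and the bound for the velocity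
  (\<open>brakke_integrand_le\<close>, \<open>first_variation_bump\<close>, \<open>brakke_variation_bump_le\<close>). The mean curvature may have
  a tangential part here: its contribution is dominated by the Hessian term
  \<open>48 \<psi>\<^sup>2 |Sy|\<^sup>2\<close>, where \<open>Sy\<close> is the projection of \<open>y = x - a\<close> to the plane \<open>S\<close>.

  Since \<open>\<psi>\<^sup>3\<close> is not bounded by a multiple of \<open>\<psi>\<^sup>4\<close>, the parameter \<open>r\<close> is made to decrease in time with a
  large constant speed, which contributes a negative multiple of \<open>\<integral>\<psi>\<^sup>3 d\<mu>\<close>. That a moving barrier
  may be used at all is a case of the theorem itself, but for this monotone barrier it can be seen
  directly: it suffices to bound the left upper derivative, and for times \<open>\<tau> < s\<close> the inequality
  \<open>\<integral>\<psi>\<^sup>3 d\<mu> \<tau> \<ge> \<integral>\<psi>\<^sup>3 d\<mu> s - C (s - \<tau>)\<close> has the right direction (\<open>barrier_bound\<close>, \<open>dini_bound\<close>). Hence the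
  mass in the ball of half the radius is controlled, for a time comparable to \<open>R\<^sup>2 / (\<Lambda> + 1)\<close>, by the finite
  mass of \<open>\<mu> t0\<close> at one earlier time \<open>t0\<close> (\<open>ball_mass_bound\<close>), and finitely many balls cover a compact
  set (\<open>compact_mass_bound\<close>).
\<close>

section \<open>Continuously differentiable test functions\<close>

lemma cont_diff1_affine:
  assumes "bounded_linear L"
  shows "cont_diff1 (\<lambda>x. L (x - a))"
  unfolding cont_diff1_def
proof (intro exI[of _ "\<lambda>_. Blinfun L"] conjI allI)
  fix x
  have "((\<lambda>x. L (x - a)) has_derivative L) (at x)"
    by (rule bounded_linear.has_derivative[OF assms]) (auto intro!: derivative_eq_intros)
  then show "((\<lambda>x. L (x - a)) has_derivative blinfun_apply (Blinfun L)) (at x)"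
    by (simp add: bounded_linear_Blinfun_apply assms)
qed simp

lemma cont_diff1_scaleR:
  fixes c :: "'a::real_normed_vector \<Rightarrow> real" and F :: "'a \<Rightarrow> 'b::real_normed_vector"
  assumes "cont_diff1 c" and "cont_diff1 F"
  shows "cont_diff1 (\<lambda>x. c x *\<^sub>R F x)"
proof -
  obtain Dc where Dc: "\<And>x. (c has_derivative blinfun_apply (Dc x)) (at x)" "continuous_on UNIV Dc"
    using assms(1) by (auto simp: cont_diff1_def)
  obtain DF where DF: "\<And>x. (F has_derivative blinfun_apply (DF x)) (at x)" "continuous_on UNIV DF"
    using assms(2) by (auto simp: cont_diff1_def)
  have cont: "continuous_on UNIV c" "continuous_on UNIV F"
    using Dc(1) DF(1) by (auto simp: continuous_on_eq_continuous_at intro: has_derivative_continuous)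
  show ?thesis
    unfolding cont_diff1_def
  proof (intro exI[of _ "\<lambda>x. (blinfun_scaleR_left (F x) o\<^sub>L Dc x) + c x *\<^sub>R DF x"] conjI allI)
    fix x
    show "((\<lambda>x. c x *\<^sub>R F x) has_derivative
        blinfun_apply ((blinfun_scaleR_left (F x) o\<^sub>L Dc x) + c x *\<^sub>R DF x)) (at x)"
      by (rule has_derivative_eq_rhs[OF has_derivative_scaleR[OF Dc(1) DF(1)]])
        (auto simp: blinfun.bilinear_simps)
    show "continuous_on UNIV (\<lambda>x. (blinfun_scaleR_left (F x) o\<^sub>L Dc x) + c x *\<^sub>R DF x)"
      by (intro continuous_intros cont Dc(2) DF(2)
          bounded_linear.continuous_on[OF bounded_linear_blinfun_scaleR_left])
  qed
qed

lemma cont_diff1_diff: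
  assumes "cont_diff1 f" and "cont_diff1 g"
  shows "cont_diff1 (\<lambda>x. f x - g x)"
proof -
  obtain Df where Df: "\<And>x. (f has_derivative blinfun_apply (Df x)) (at x)" "continuous_on UNIV Df"
    using assms(1) by (auto simp: cont_diff1_def)
  obtain Dg where Dg: "\<And>x. (g has_derivative blinfun_apply (Dg x)) (at x)" "continuous_on UNIV Dg"
    using assms(2) by (auto simp: cont_diff1_def)
  show ?thesis
    unfolding cont_diff1_def
  proof (intro exI[of _ "\<lambda>x. Df x - Dg x"] conjI allI)
    show "((\<lambda>x. f x - g x) has_derivative blinfun_apply (Df x - Dg x)) (at x)" for x
      by (rule has_derivative_eq_rhs[OF has_derivative_diff[OF Df(1) Dg(1)]])
        (auto simp: blinfun.bilinear_simps)
  qed (intro continuous_intros Df Dg)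
qed

lemma cont_diff1_const: "cont_diff1 (\<lambda>_. c)"
  unfolding cont_diff1_def by (intro exI[of _ "\<lambda>_. 0"]) (auto simp: zero_blinfun.rep_eq)

lemma cont_diff1_continuous: "cont_diff1 f \<Longrightarrow> continuous_on UNIV f"
  by (auto simp: cont_diff1_def continuous_on_eq_continuous_at intro: has_derivative_continuous)

lemma notin_supp: "x \<notin> supp f \<Longrightarrow> f x = 0"
  using closure_subset[of "{x. f x \<noteq> 0}"] by (auto simp: supp_def)

lemma closed_supp: "closed (supp f)"
  by (simp add: supp_def)

lemma supp_subset_closed: "closed K \<Longrightarrow> (\<And>x. x \<notin> K \<Longrightarrow> f x = 0) \<Longrightarrow> supp f \<subseteq> K"
  unfolding supp_def by (rule closure_minimal) auto

lemma Cc1I: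
  assumes "cont_diff1 f" "compact K" "K \<subseteq> U" "\<And>x. x \<notin> K \<Longrightarrow> f x = 0"
  shows "f \<in> Cc1 U"
proof -
  have "supp f \<subseteq> K"
    using assms by (intro supp_subset_closed compact_imp_closed)
  moreover from this have "compact (supp f)"
    using compact_Int_closed[OF assms(2), of "supp f"] by (simp add: inf.absorb2 closed_supp)
  ultimately show ?thesis
    using assms unfolding Cc1_def by auto
qed

lemma Cc1_diff:
  assumes "f \<in> Cc1 U" "g \<in> Cc1 U"
  shows "(\<lambda>x. f x - g x) \<in> Cc1 U"
  using assms
  by (intro Cc1I[where K = "supp f \<union> supp g"] cont_diff1_diff)
    (auto simp: Cc1_def notin_supp intro: compact_Un)

lemma Cc1_divide:
  fixes f :: "'a::real_normed_vector \<Rightarrow> real"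
  assumes "f \<in> Cc1 U"
  shows "(\<lambda>x. f x / c) \<in> Cc1 U"
proof -
  have "cont_diff1 (\<lambda>x. (inverse c) *\<^sub>R f x)"
    using assms by (intro cont_diff1_scaleR[OF cont_diff1_const]) (auto simp: Cc1_def)
  then have "cont_diff1 (\<lambda>x. f x / c)" by (simp add: field_simps)
  then show ?thesis
    using assms by (intro Cc1I[where K = "supp f"]) (auto simp: Cc1_def notin_supp)
qed

section \<open>The \<open>C\<^sup>1\<close> norm and time derivatives\<close>

lemma gradient_eqI:
  assumes "(f has_derivative (\<lambda>h. h \<bullet> D)) (at x)"
  shows "gradient f x = D"
  unfolding gradient_def
proof (rule the_equality)
  show "GDERIV f x :> D" using assms by (simp add: gderiv_def)
  fix E assume "GDERIV f x :> E"
  then have "(\<lambda>h. h \<bullet> E) = (\<lambda>h. h \<bullet> D)"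
    using assms has_derivative_unique by (auto simp: gderiv_def)
  then have "(E - D) \<bullet> E = (E - D) \<bullet> D" by meson
  then have "(E - D) \<bullet> (E - D) = 0" by (simp add: inner_diff_right)
  then show "E = D" by simp
qed

text \<open>\<open>C1_norm\<close> adds a supremum of gradients to the supremum of the function, and a supremum over an
  unbounded set of reals has no prescribed value. Compact support makes the gradient bounded, so
  its supremum is nonnegative and can be dropped.\<close>
lemma abs_le_C1_norm:
  fixes f :: "'a::euclidean_space \<Rightarrow> real"
  assumes "f \<in> Cc1 U"
  shows "\<bar>f x\<bar> \<le> C1_norm f"
proof -
  have cd: "cont_diff1 f" and cp: "compact (supp f)" using assms by (auto simp: Cc1_def)
  obtain D where D: "\<And>x. (f has_derivative blinfun_apply (D x)) (at x)" "continuous_on UNIV D"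
    using cd by (auto simp: cont_diff1_def)
  define G where "G x = (\<Sum>b\<in>Basis. D x b *\<^sub>R b)" for x
  have "D x h = h \<bullet> G x" for x h
  proof -
    have "D x h = D x (\<Sum>b\<in>Basis. (h \<bullet> b) *\<^sub>R b)" by (simp add: euclidean_representation)
    then show ?thesis
      by (simp add: G_def blinfun.bilinear_simps blinfun.sum_right inner_sum_right mult.commute)
  qed
  then have DG: "blinfun_apply (D x) = (\<lambda>h. h \<bullet> G x)" for x by blast
  have fG: "(f has_derivative (\<lambda>h. h \<bullet> G x)) (at x)" for x
    using D(1)[of x] unfolding DG .
  then have grad: "gradient f = G"
    by (intro ext gradient_eqI)
  have contG: "continuous_on UNIV G"
    unfolding G_def by (intro continuous_intros D)
  have zero: "G x = 0" if "x \<notin> supp f" for x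
  proof -
    have "((\<lambda>_. 0) has_derivative (\<lambda>h. h \<bullet> G x)) (at x)"
      by (rule has_derivative_transform_within_open[OF fG, of "- supp f"])
        (use that in \<open>auto simp: notin_supp closed_supp open_Compl\<close>)
    then have "(\<lambda>h. h \<bullet> G x) = (\<lambda>_. 0)"
      using has_derivative_const has_derivative_unique by blast
    from fun_cong[OF this, of "G x"] have "G x \<bullet> G x = 0" by simp
    then show ?thesis by simp
  qed
  have bdd: "bdd_above (range h)" if h: "continuous_on UNIV h" "\<And>x. x \<notin> supp f \<Longrightarrow> h x = 0"
    for h :: "'a \<Rightarrow> real"
  proof -
    have "compact (h ` supp f)"
      using h(1) cp by (meson compact_continuous_image continuous_on_subset subset_UNIV)
    then have "bdd_above (insert 0 (h ` supp f))"
      by (simp add: bounded_imp_bdd_above compact_imp_bounded)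
    moreover have "range h \<subseteq> insert 0 (h ` supp f)" using h(2) by auto
    ultimately show ?thesis by (rule bdd_above_mono)
  qed
  have "bdd_above (range (\<lambda>x. norm (gradient f x)))"
    unfolding grad by (rule bdd) (auto intro!: continuous_intros contG zero)
  then have "0 \<le> (SUP x. norm (gradient f x))"
    by (rule cSUP_upper2[where x = 0]) auto
  moreover have "bdd_above (range (\<lambda>x. \<bar>f x\<bar>))"
    using notin_supp[of _ f] by (intro bdd continuous_intros cont_diff1_continuous cd) simp
  then have "\<bar>f x\<bar> \<le> (SUP x. \<bar>f x\<bar>)" by (intro cSUP_upper) simp_all
  ultimately show ?thesis by (simp add: C1_norm_def)
qed

text \<open>The \<open>C\<^sup>1\<close> limit of the difference quotients is also their pointwise limit, hence unique as soon
  as \<open>s\<close> is a limit point of \<open>I\<close>.\<close>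
lemma time_derivative_eq:
  fixes \<phi> :: "real \<Rightarrow> 'a::euclidean_space \<Rightarrow> real"
  assumes der: "has_Cc1_time_derivative \<phi> \<psi> I U s"
    and \<phi>: "\<And>t. t \<in> I \<Longrightarrow> \<phi> t \<in> Cc1 U" and s: "s \<in> I" "at s within I \<noteq> bot"
  shows "time_derivative \<phi> I U s = \<psi>"
  unfolding time_derivative_def
proof (rule the_equality[where P = "\<lambda>\<psi>. has_Cc1_time_derivative \<phi> \<psi> I U s", OF der])
  fix \<psi>' assume der': "has_Cc1_time_derivative \<phi> \<psi>' I U s"
  have lim: "((\<lambda>t. (\<phi> t x - \<phi> s x) / (t - s)) \<longlongrightarrow> \<eta> x) (at s within I)"
    if der: "has_Cc1_time_derivative \<phi> \<eta> I U s" for \<eta> x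
  proof -
    have "\<forall>\<^sub>F t in at s within I.
        norm ((\<phi> t x - \<phi> s x) / (t - s) - \<eta> x) \<le> C1_norm (\<lambda>x. (\<phi> t x - \<phi> s x) / (t - s) - \<eta> x)"
      unfolding eventually_at_filter
    proof (intro always_eventually allI impI)
      fix t assume "t \<in> I"
      then have "(\<lambda>x. (\<phi> t x - \<phi> s x) / (t - s) - \<eta> x) \<in> Cc1 U"
        using der s \<phi> by (intro Cc1_diff Cc1_divide) (auto simp: has_Cc1_time_derivative_def)
      from abs_le_C1_norm[OF this]
      show "norm ((\<phi> t x - \<phi> s x) / (t - s) - \<eta> x)
          \<le> C1_norm (\<lambda>x. (\<phi> t x - \<phi> s x) / (t - s) - \<eta> x)" by simp
    qed
    then have "((\<lambda>t. (\<phi> t x - \<phi> s x) / (t - s) - \<eta> x) \<longlongrightarrow> 0) (at s within I)"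
      by (rule Lim_null_comparison) (use der in \<open>simp add: has_Cc1_time_derivative_def\<close>)
    then show ?thesis by (rule Lim_null[THEN iffD2])
  qed
  show "\<psi>' = \<psi>"
    by (intro ext tendsto_unique[OF s(2) lim[OF der'] lim[OF der]])
qed

section \<open>Truncated powers\<close>

text \<open>The parameter \<open>r\<close> is the square of the radius. This makes \<open>r\<close> enter the base of the power
  linearly: shrinking \<open>r\<close> at constant speed gives the barrier of the mass bound.\<close>
definition bump :: "nat \<Rightarrow> 'a::real_inner \<Rightarrow> real \<Rightarrow> 'a \<Rightarrow> real" where
  "bump p a r x = max 0 (r - (norm (x - a))\<^sup>2) ^ p"

lemma pos_part_power_has_derivative:
  assumes "p \<ge> 2"
  shows "((\<lambda>y::real. max 0 y ^ p) has_real_derivative real p * max 0 y ^ (p - 1)) (at y)"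
proof (cases "y = 0")
  case False
  then consider "y > 0" | "y < 0" by linarith
  then show ?thesis
  proof cases
    case 1
    have "((\<lambda>y::real. y ^ p) has_real_derivative real p * max 0 y ^ (p - 1)) (at y)"
      using 1 by (auto intro!: derivative_eq_intros)
    then show ?thesis
      by (rule has_field_derivative_transform_within_open[where S = "{0<..}"]) (use 1 in auto)
  next
    case 2
    have "((\<lambda>y::real. 0) has_real_derivative real p * max 0 y ^ (p - 1)) (at y)"
      using 2 assms by (auto intro!: derivative_eq_intros)
    then show ?thesis
      by (rule has_field_derivative_transform_within_open[where S = "{..<0}"]) (use 2 assms in auto)
  qed
next
  case True
  (* At the kink the difference quotient is at most |h| ^ (p - 1), and p >= 2. *)
  have "((\<lambda>h::real. max 0 h ^ p / h) \<longlongrightarrow> 0) (at 0)"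
  proof (rule Lim_null_comparison)
    have "norm (max 0 h ^ p / h) \<le> \<bar>h\<bar> ^ (p - 1)" if "h \<noteq> 0" for h :: real
    proof -
      have p: "p = Suc (p - 1)" using assms by simp
      show ?thesis
        using that by (subst p) (auto simp: max_def)
    qed
    then show "\<forall>\<^sub>F h in at 0. norm (max 0 h ^ p / h :: real) \<le> \<bar>h\<bar> ^ (p - 1)"
      by (auto simp: eventually_at_filter)
    have "((\<lambda>h::real. \<bar>h\<bar> ^ (p - 1)) \<longlongrightarrow> \<bar>0\<bar> ^ (p - 1)) (at 0)"
      by (intro tendsto_intros)
    then show "((\<lambda>h::real. \<bar>h\<bar> ^ (p - 1)) \<longlongrightarrow> 0) (at 0)"
      using assms by (simp add: power_0_left)
  qed
  then show ?thesis
    using True assms by (simp add: DERIV_def power_0_left)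
qed

lemma bump_has_derivative:
  assumes "p \<ge> 2"
  shows "(bump p a r has_derivative (\<lambda>h. - (2 * real p * bump (p - 1) a r x) * (h \<bullet> (x - a)))) (at x)"
proof -
  have "((\<lambda>x. r - (norm (x - a))\<^sup>2) has_derivative (\<lambda>h. - (2 * (h \<bullet> (x - a))))) (at x)"
    unfolding power2_norm_eq_inner
    by (auto intro!: derivative_eq_intros simp: inner_commute)
  from has_derivative_compose[OF this
      pos_part_power_has_derivative[OF assms, THEN has_field_derivative_imp_has_derivative]]
  show ?thesis
    unfolding bump_def[abs_def] by (rule has_derivative_eq_rhs) (auto simp: algebra_simps)
qed

lemma gradient_bump:
  assumes "p \<ge> 2"
  shows "gradient (bump p a r) x = - (2 * real p * bump (p - 1) a r x) *\<^sub>R (x - a)"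
  by (rule gradient_eqI, rule has_derivative_eq_rhs[OF bump_has_derivative[OF assms]]) auto

lemma continuous_bump: "continuous_on UNIV (bump p a r)"
  unfolding bump_def[abs_def] by (intro continuous_intros)

lemma cont_diff1_bump:
  assumes "p \<ge> 2"
  shows "cont_diff1 (bump p a r)"
  unfolding cont_diff1_def
proof (intro exI[of _ "\<lambda>x. (- (2 * real p * bump (p - 1) a r x)) *\<^sub>R blinfun_inner_left (x - a)"]
    conjI allI)
  show "(bump p a r has_derivative
      blinfun_apply ((- (2 * real p * bump (p - 1) a r x)) *\<^sub>R blinfun_inner_left (x - a))) (at x)" for x
    by (rule has_derivative_eq_rhs[OF bump_has_derivative[OF assms]])
      (auto simp: blinfun.bilinear_simps)
qed (intro continuous_intros continuous_bump
    bounded_linear.continuous_on[OF bounded_linear_blinfun_inner_left])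

lemma cont_diff2_bump:
  assumes "p \<ge> 3"
  shows "cont_diff2 (bump p a r)"
  unfolding cont_diff2_def
proof (intro exI[of _ "\<lambda>x. bump (p - 1) a r x *\<^sub>R (- (2 * real p)) *\<^sub>R blinfun_inner_left (x - a)"]
    conjI allI)
  show "(bump p a r has_derivative
      blinfun_apply (bump (p - 1) a r x *\<^sub>R (- (2 * real p)) *\<^sub>R blinfun_inner_left (x - a))) (at x)" for x
    using assms
    by (intro has_derivative_eq_rhs[OF bump_has_derivative])
      (auto simp: blinfun.bilinear_simps)
  show "cont_diff1 (\<lambda>x. bump (p - 1) a r x *\<^sub>R (- (2 * real p)) *\<^sub>R blinfun_inner_left (x - a))"
    using assms
    by (intro cont_diff1_scaleR cont_diff1_bump
        cont_diff1_affine[where L = "\<lambda>v. (- (2 * real p)) *\<^sub>R blinfun_inner_left v"]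
        bounded_linear_scaleR_right[THEN bounded_linear_compose] bounded_linear_blinfun_inner_left) auto
qed

lemma bump_nonneg: "0 \<le> bump p a r x"
  by (simp add: bump_def)

lemma bump_pos_iff: "p \<ge> 1 \<Longrightarrow> 0 < bump p a r x \<longleftrightarrow> (norm (x - a))\<^sup>2 < r"
  by (cases "(norm (x - a))\<^sup>2 < r") (auto simp: bump_def max_def power_0_left)

lemma bump_le: "r \<ge> 0 \<Longrightarrow> bump p a r x \<le> r ^ p"
  unfolding bump_def by (intro power_mono) auto

lemma bump_mono: "r \<le> r' \<Longrightarrow> bump p a r x \<le> bump p a r' x"
  unfolding bump_def by (intro power_mono) auto

lemma bump_eq_0: "p \<ge> 1 \<Longrightarrow> r \<le> R\<^sup>2 \<Longrightarrow> 0 \<le> R \<Longrightarrow> x \<notin> cball a R \<Longrightarrow> bump p a r x = 0"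
proof -
  assume "p \<ge> 1" and "r \<le> R\<^sup>2" and "0 \<le> R" "x \<notin> cball a R"
  then have "R\<^sup>2 \<le> (norm (x - a))\<^sup>2"
    by (intro power_mono) (auto simp: dist_norm norm_minus_commute)
  then show ?thesis
    using \<open>p \<ge> 1\<close> \<open>r \<le> R\<^sup>2\<close> by (auto simp: bump_def max_def power_0_left)
qed

lemma bump_in_Cc2:
  fixes a :: "'a::euclidean_space"
  assumes "p \<ge> 3" "r \<le> R\<^sup>2" "0 \<le> R" "cball a R \<subseteq> U"
  shows "bump p a r \<in> Cc2 U"
proof -
  have "bump p a r \<in> Cc1 U"
    using assms by (intro Cc1I[where K = "cball a R"] cont_diff1_bump bump_eq_0[where R = R]) auto
  then show ?thesis
    using assms by (auto simp: Cc2_def Cc1_def cont_diff2_bump)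
qed

text \<open>Bernoulli's inequality, i.e. convexity of the power, bounds from below what the barrier loses
  when \<open>r\<close> decreases by \<open>h\<close>. The bound has power \<open>p\<close>, the same as the growth term that it has to
  compensate.\<close>
lemma bump_shift:
  assumes "h \<ge> 0" and "p \<ge> 1"
  shows "bump (Suc p) a (r + h) x \<ge> bump (Suc p) a r x + real (Suc p) * h * bump p a r x"
proof (cases "r - (norm (x - a))\<^sup>2 > 0")
  case True
  define y where "y = r - (norm (x - a))\<^sup>2"
  have y: "y > 0" using True by (simp add: y_def)
  have "y ^ Suc p + real (Suc p) * h * y ^ p = y ^ Suc p * (1 + real (Suc p) * (h / y))"
    using y by (simp add: field_simps)
  also have "\<dots> \<le> y ^ Suc p * (1 + h / y) ^ Suc p"
    using y assms by (intro mult_left_mono Bernoulli_inequality) (auto intro: order_trans[of _ 0])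
  also have "\<dots> = (y + h) ^ Suc p"
    using y by (simp add: power_mult_distrib[symmetric] field_simps del: power_Suc)
  also have "max 0 (r - (norm (x - a))\<^sup>2) = y" "max 0 (r + h - (norm (x - a))\<^sup>2) = y + h"
    using y assms by (auto simp: y_def)
  ultimately show ?thesis unfolding bump_def by simp
next
  case False
  then show ?thesis using assms by (cases p) (auto simp: bump_def max_def)
qed

section \<open>Orthogonal projections and compactness of the Grassmannian\<close>

lemma orth_proj_eqI:
  assumes "subspace S" "y \<in> S" "x - y \<in> S\<^sup>\<bottom>"
  shows "orth_proj S x = y"
  unfolding orth_proj_def
proof (rule the_equality)
  fix z assume z: "z \<in> S \<and> x - z \<in> S\<^sup>\<bottom>"
  have "(x - y) - (x - z) \<in> S\<^sup>\<bottom>"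
    using z assms subspace_diff[OF subspace_orthogonal_comp] by blast
  then have "z - y \<in> S \<inter> S\<^sup>\<bottom>"
    using z assms by (auto intro: subspace_diff)
  then show "z = y" using orthogonal_Int_0[OF assms(1)] by auto
qed (use assms in auto)

lemma orth_proj_decomp:
  assumes "subspace S"
  shows "orth_proj S x \<in> S" and "x - orth_proj S x \<in> S\<^sup>\<bottom>"
proof -
  obtain y z where "x = y + z" "y \<in> S" "z \<in> S\<^sup>\<bottom>"
    using subspace_sum_orthogonal_comp[OF assms] by (metis UNIV_I set_plus_elim)
  with orth_proj_eqI[OF assms, of y x]
  show "orth_proj S x \<in> S" "x - orth_proj S x \<in> S\<^sup>\<bottom>" by auto
qed

lemma linear_orth_proj:
  assumes "subspace S"
  shows "linear (orth_proj S)"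
proof (rule linearI)
  note d = orth_proj_decomp[OF assms]
  show "orth_proj S (x + y) = orth_proj S x + orth_proj S y" for x y
  proof (rule orth_proj_eqI[OF assms])
    show "x + y - (orth_proj S x + orth_proj S y) \<in> S\<^sup>\<bottom>"
      using subspace_add[OF subspace_orthogonal_comp d(2)[of x] d(2)[of y]]
      by (simp add: algebra_simps)
  qed (intro subspace_add assms d)
  show "orth_proj S (c *\<^sub>R x) = c *\<^sub>R orth_proj S x" for c x
  proof (rule orth_proj_eqI[OF assms])
    show "c *\<^sub>R x - c *\<^sub>R orth_proj S x \<in> S\<^sup>\<bottom>"
      using subspace_mul[OF subspace_orthogonal_comp d(2)[of x], of c]
      by (simp add: scaleR_diff_right)
  qed (intro subspace_mul assms d)
qed

lemma inner_orth_proj: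
  assumes "subspace S"
  shows "orth_proj S x \<bullet> y = orth_proj S x \<bullet> orth_proj S y"
  using orth_proj_decomp[OF assms, of x] orth_proj_decomp[OF assms, of y]
  by (auto simp: orthogonal_comp_def orthogonal_def inner_diff_right)

lemma orth_proj_comp:
  assumes "subspace S"
  shows "orth_proj (S\<^sup>\<bottom>) x = x - orth_proj S x"
  using orth_proj_decomp[OF assms, of x] orthogonal_comp_subset[of S]
  by (intro orth_proj_eqI subspace_orthogonal_comp) auto

lemma norm_orth_proj_le:
  assumes "subspace S"
  shows "norm (orth_proj S x) \<le> norm x"
proof -
  have "(norm (orth_proj S x))\<^sup>2 = orth_proj S x \<bullet> x"
    by (simp add: power2_norm_eq_inner inner_orth_proj[OF assms, of x x])
  also have "\<dots> \<le> norm (orth_proj S x) * norm x" by (rule norm_cauchy_schwarz)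
  finally show ?thesis
    by (cases "norm (orth_proj S x) = 0") (auto simp: power2_eq_square)
qed

lemma norm_orth_comp_le:
  assumes "subspace S"
  shows "norm (x - orth_proj S x) \<le> norm x"
  using norm_orth_proj_le[OF subspace_orthogonal_comp, of S x] orth_proj_comp[OF assms] by simp

lemma matrix_orth_proj_mult:
  fixes S :: "(real ^ 'm) set"
  assumes "subspace S"
  shows "matrix (orth_proj S) *v x = orth_proj S x"
  using fun_cong[OF matrix_vector_mul(2)[OF linear_orth_proj[OF assms]], of x] by simp

lemma inner_matrix_vector_mult:
  fixes A :: "real ^ 'm ^ 'm"
  shows "(A *v z) \<bullet> y = z \<bullet> (transpose A *v y)"
  by (metis dot_lmul_matrix inner_commute transpose_matrix_vector)

text \<open>The trace turns the condition on the dimension of a subspace into a closed condition on its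
  projection matrix.\<close>
lemma trace_orth_proj:
  fixes S :: "(real ^ 'm) set"
  assumes S: "subspace S"
  shows "trace (matrix (orth_proj S)) = real (dim S)"
proof -
  obtain B where B: "B \<subseteq> S" "pairwise orthogonal B" "\<And>x. x \<in> B \<Longrightarrow> norm x = 1"
    "independent B" "card B = dim S" "span B = S"
    using orthonormal_basis_subspace[OF S] by metis
  have "finite B" using B(4) by (rule independent_imp_finite)
  have ortho: "b \<bullet> c = (if b = c then 1 else 0)" if "b \<in> B" "c \<in> B" for b c
    using B that by (auto simp: pairwise_def orthogonal_def norm_eq_1)
  have P: "orth_proj S x = (\<Sum>b\<in>B. (x \<bullet> b) *\<^sub>R b)" for x
  proof (rule orth_proj_eqI[OF S])
    show "(\<Sum>b\<in>B. (x \<bullet> b) *\<^sub>R b) \<in> S"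
      using B(1) by (intro subspace_sum[OF S] subspace_mul[OF S]) auto
    have "orthogonal (x - (\<Sum>b\<in>B. (x \<bullet> b) *\<^sub>R b)) c" if "c \<in> B" for c
    proof -
      have "(\<Sum>b\<in>B. (x \<bullet> b) * (b \<bullet> c)) = (\<Sum>b\<in>B. if b = c then x \<bullet> b else 0)"
        using that ortho by (intro sum.cong) auto
      then show ?thesis
        using that \<open>finite B\<close> by (simp add: orthogonal_def inner_diff_left inner_sum_left)
    qed
    then have "orthogonal (x - (\<Sum>b\<in>B. (x \<bullet> b) *\<^sub>R b)) c" if "c \<in> S" for c
      using that B(6) by (intro orthogonal_to_span[of c B]) auto
    then show "x - (\<Sum>b\<in>B. (x \<bullet> b) *\<^sub>R b) \<in> S\<^sup>\<bottom>"
      by (simp add: orthogonal_comp_def orthogonal_commute)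
  qed
  have "trace (matrix (orth_proj S)) = (\<Sum>i\<in>UNIV. \<Sum>b\<in>B. b $ i * b $ i)"
    by (simp add: trace_def matrix_def P inner_axis' cong: sum.cong)
  also have "\<dots> = (\<Sum>b\<in>B. b \<bullet> b)"
    by (subst sum.swap) (simp add: inner_vec_def)
  also have "\<dots> = real (card B)"
    using ortho by simp
  finally show ?thesis using B(5) by simp
qed

lemma image_grassmannian:
  "(\<lambda>S. matrix (orth_proj S)) ` (grassmannian n :: (real ^ 'm) set set) =
     {A. transpose A = A \<and> A ** A = A \<and> trace A = real n}" (is "?f ` ?G = ?M")
proof (intro equalityI subsetI)
  fix A assume "A \<in> ?f ` ?G"
  then obtain S where S: "subspace S" "dim S = n" and A: "A = matrix (orth_proj S)"
    by (auto simp: grassmannian_def)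
  note m = matrix_orth_proj_mult[OF S(1)]
  have "A *v (A *v x) = A *v x" for x
    unfolding A m
    by (rule orth_proj_eqI[OF S(1)])
      (use orth_proj_decomp[OF S(1)] in \<open>auto simp: subspace_0 subspace_orthogonal_comp\<close>)
  then have "A ** A = A" by (simp add: matrix_eq matrix_vector_mul_assoc[symmetric])
  moreover have "x \<bullet> (transpose A *v y) = x \<bullet> (A *v y)" for x y
    using inner_orth_proj[OF S(1), of x y] inner_orth_proj[OF S(1), of y x]
    unfolding inner_matrix_vector_mult[symmetric] by (simp add: A m inner_commute)
  then have "transpose A *v y = A *v y" for y
    using vector_eq_ldot by blast
  then have "transpose A = A"
    by (simp add: matrix_eq del: transpose_matrix_vector)
  ultimately show "A \<in> ?M"
    using trace_orth_proj[OF S(1)] S(2) by (simp add: A)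
next
  fix A assume "A \<in> ?M"
  then have A: "transpose A = A" "A ** A = A" "trace A = real n" by auto
  define S where "S = range ((*v) A)"
  have S: "subspace S"
    unfolding S_def by (intro linear_subspace_image matrix_vector_mul_linear) auto
  have "orth_proj S x = A *v x" for x
  proof (rule orth_proj_eqI[OF S])
    show "A *v x \<in> S" by (auto simp: S_def)
    have "(A *v z) \<bullet> (x - A *v x) = 0" for z
    proof -
      have "(A *v z) \<bullet> (x - A *v x) = z \<bullet> (A *v (x - A *v x))"
        unfolding inner_matrix_vector_mult A(1) ..
      also have "A *v (x - A *v x) = 0"
        by (simp add: matrix_vector_mult_diff_distrib matrix_vector_mul_assoc A)
      finally show ?thesis by simp
    qed
    then show "x - A *v x \<in> S\<^sup>\<bottom>"
      by (auto simp: orthogonal_comp_def orthogonal_def S_def)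
  qed
  then have "orth_proj S = (*v) A" by (intro ext)
  then have fS: "matrix (orth_proj S) = A" by simp
  then have "dim S = n" using trace_orth_proj[OF S] A(3) by simp
  with fS S show "A \<in> ?f ` ?G" by (auto simp: grassmannian_def)
qed

text \<open>A symmetric idempotent \<open>A\<close> has squared Frobenius norm \<open>trace (A ** transpose A) = trace A\<close>, so
  fixing the trace bounds the set; all three conditions are closed.\<close>
lemma compact_image_grassmannian:
  "compact ((\<lambda>S. matrix (orth_proj S)) ` (grassmannian n :: (real ^ 'm) set set))"
  unfolding image_grassmannian
proof (rule compact_eq_bounded_closed[THEN iffD2], intro conjI)
  have "norm A \<le> sqrt (real n)" if "transpose A = A" "A ** A = A" "trace A = real n"
    for A :: "real ^ 'm ^ 'm"
  proof -
    have "(norm A)\<^sup>2 = (\<Sum>i\<in>UNIV. \<Sum>j\<in>UNIV. A $ i $ j * A $ i $ j)"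
      by (simp add: power2_norm_eq_inner inner_vec_def)
    also have "\<dots> = (\<Sum>i\<in>UNIV. (A ** transpose A) $ i $ i)"
      by (simp add: matrix_matrix_mult_def transpose_def)
    also have "\<dots> = real n" using that by (simp add: trace_def)
    finally show ?thesis by (metis norm_ge_zero real_sqrt_le_iff real_sqrt_unique order_refl)
  qed
  then show "bounded {A :: real ^ 'm ^ 'm. transpose A = A \<and> A ** A = A \<and> trace A = real n}"
    unfolding bounded_iff by blast
  show "closed {A :: real ^ 'm ^ 'm. transpose A = A \<and> A ** A = A \<and> trace A = real n}"
    unfolding vec_eq_iff transpose_def matrix_matrix_mult_def trace_def
    by (auto intro!: closed_Collect_conj closed_Collect_all closed_Collect_eq continuous_intros)
qed

text \<open>With this, \<open>K \<times> grassmannian n\<close> is compact for compact \<open>K\<close>, which is what makes the weight of a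
  varifold finite on \<open>K\<close>.\<close>
lemma compactin_grassmannian:
  "compactin (grassmannian_topology n) (grassmannian n :: (real ^ 'm) set set)"
proof -
  let ?f = "\<lambda>S::(real ^ 'm) set. matrix (orth_proj S)" and ?G = "grassmannian n :: (real ^ 'm) set set"
  have top: "topspace (grassmannian_topology n) = ?G"
    by (simp add: grassmannian_topology_def topspace_pullback_topology)
  show ?thesis
    unfolding compactin_def
  proof (intro conjI allI impI)
    show "?G \<subseteq> topspace (grassmannian_topology n)" by (simp add: top)
    fix \<U> assume \<U>: "Ball \<U> (openin (grassmannian_topology n)) \<and> ?G \<subseteq> \<Union>\<U>"
    define W where "W u = (SOME w. open w \<and> u = ?f -` w \<inter> ?G)" for u
    have W: "open (W u)" "u = ?f -` W u \<inter> ?G" if "u \<in> \<U>" for u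
    proof -
      have "\<exists>w. open w \<and> u = ?f -` w \<inter> ?G"
        using \<U> that by (auto simp: grassmannian_topology_def openin_pullback_topology)
      from someI_ex[OF this] show "open (W u)" "u = ?f -` W u \<inter> ?G" by (auto simp: W_def)
    qed
    have "?f ` ?G \<subseteq> (\<Union>u\<in>\<U>. W u)"
    proof
      fix A assume "A \<in> ?f ` ?G"
      then obtain S where "S \<in> ?G" "A = ?f S" by auto
      then show "A \<in> (\<Union>u\<in>\<U>. W u)" using \<U> W(2) by blast
    qed
    with compactE_image[OF compact_image_grassmannian, of \<U> W] W(1)
    obtain F where F: "F \<subseteq> \<U>" "finite F" "?f ` ?G \<subseteq> (\<Union>u\<in>F. W u)" by metis
    have "?G \<subseteq> \<Union>F"
    proof
      fix S assume "S \<in> ?G"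
      moreover from this F obtain u where "u \<in> F" "?f S \<in> W u" by blast
      ultimately show "S \<in> \<Union>F" using W(2)[of u] F(1) by blast
    qed
    with F show "\<exists>\<F>. finite \<F> \<and> \<F> \<subseteq> \<U> \<and> ?G \<subseteq> \<Union>\<F>" by blast
  qed
qed

section \<open>Integration against varifolds and their weights\<close>

lemma topspace_Gr_bundle: "topspace (Gr_bundle n U) = U \<times> grassmannian n"
  by (simp add: Gr_bundle_def grassmannian_topology_def topspace_pullback_topology)

lemma space_varifold: "V \<in> varifolds n U \<Longrightarrow> space V = U \<times> grassmannian n"
  by (simp add: varifolds_def radon_measure_def topspace_Gr_bundle)

lemma borel_measurable_varifold:
  fixes f :: "(real ^ 'm) \<times> (real ^ 'm) set \<Rightarrow> 'b::topological_space"
  assumes "V \<in> varifolds n U" "continuous_map (Gr_bundle n U) euclidean f"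
  shows "f \<in> borel_measurable V"
proof (rule borel_measurableI)
  fix W :: "'b set" assume "open W"
  then have "openin (Gr_bundle n U) {z \<in> topspace (Gr_bundle n U). f z \<in> W}"
    using assms(2) by (intro openin_continuous_map_preimage[where Y = euclidean]) auto
  moreover have "f -` W \<inter> space V = {z \<in> topspace (Gr_bundle n U). f z \<in> W}"
    using assms(1) by (auto simp: varifolds_def radon_measure_def)
  ultimately show "f -` W \<inter> space V \<in> sets V"
    using assms(1) by (auto simp: varifolds_def radon_measure_def)
qed

lemma measurable_fst_varifold:
  assumes "V \<in> varifolds n U"
  shows "fst \<in> borel_measurable V" and "fst \<in> V \<rightarrow>\<^sub>M restrict_space borel U"
proof -
  have "continuous_map (Gr_bundle n U) (top_of_set U) fst"
    unfolding Gr_bundle_def by (rule continuous_map_fst)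
  then have "continuous_map (Gr_bundle n U) euclidean fst"
    by (simp add: continuous_map_in_subtopology)
  from borel_measurable_varifold[OF assms this] show m: "fst \<in> borel_measurable V" .
  show "fst \<in> V \<rightarrow>\<^sub>M restrict_space borel U"
    by (rule measurable_restrict_space2[OF _ m]) (auto simp: space_varifold[OF assms])
qed

lemma measurable_orth_proj_varifold:
  assumes "V \<in> varifolds n U"
  shows "(\<lambda>z. matrix (orth_proj (snd z))) \<in> borel_measurable V"
proof (rule borel_measurable_varifold[OF assms])
  have "continuous_map (grassmannian_topology n) euclidean (id \<circ> (\<lambda>S::(real ^ 'a) set. matrix (orth_proj S)))"
    unfolding grassmannian_topology_def by (rule continuous_map_pullback) simp
  from continuous_map_compose[OF continuous_map_snd this]
  show "continuous_map (Gr_bundle n U) euclidean (\<lambda>z. matrix (orth_proj (snd z)))"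
    by (simp add: Gr_bundle_def o_def)
qed

lemma space_weight: "space (weight U V) = U"
  by (simp add: weight_def space_restrict_space)

lemma sets_weight: "sets (weight U V) = sets (restrict_space borel U)"
  by (simp add: weight_def)

lemma borel_measurable_weight:
  "f \<in> borel_measurable borel \<Longrightarrow> f \<in> borel_measurable (weight U V)"
  using measurable_cong_sets[OF sets_weight refl] measurable_restrict_space1 by blast

lemma compact_in_sets_weight:
  fixes U :: "(real ^ 'm) set"
  assumes "open U" "compact K" "K \<subseteq> U"
  shows "K \<in> sets (weight U V)"
  using assms by (auto simp: sets_weight sets_restrict_space_iff intro!: borel_compact)

lemma emeasure_weight_compact:
  fixes U :: "(real ^ 'm) set"
  assumes V: "V \<in> varifolds n U" and K: "open U" "compact K" "K \<subseteq> U"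
  shows "emeasure (weight U V) K < \<infinity>"
proof -
  have "emeasure (weight U V) K = emeasure V (fst -` K \<inter> space V)"
    unfolding weight_def
    by (rule emeasure_distr[OF measurable_fst_varifold(2)[OF V]])
      (use compact_in_sets_weight[OF K] in \<open>simp add: sets_weight\<close>)
  also have "fst -` K \<inter> space V = K \<times> grassmannian n"
    using K by (auto simp: space_varifold[OF V])
  also have "emeasure V (K \<times> grassmannian n) < \<infinity>"
  proof -
    have "compactin (Gr_bundle n U) (K \<times> grassmannian n)"
      unfolding Gr_bundle_def using compactin_grassmannian[of n] K
      by (auto simp: compactin_Times compactin_subtopology)
    then show ?thesis using V by (simp add: varifolds_def radon_measure_def)
  qed
  finally show ?thesis .
qed

lemma integrable_weight_bounded:
  fixes U :: "(real ^ 'm) set" and f :: "real ^ 'm \<Rightarrow> real"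
  assumes V: "V \<in> varifolds n U" "open U" "compact K" "K \<subseteq> U"
    and f: "f \<in> borel_measurable (weight U V)" "\<And>x. x \<in> K \<Longrightarrow> \<bar>f x\<bar> \<le> B" "\<And>x. x \<notin> K \<Longrightarrow> f x = 0"
  shows "integrable (weight U V) f"
  using assms emeasure_weight_compact[OF V] compact_in_sets_weight[OF V(2-)]
  by (intro integrableI_bounded_set[where A = K and B = B]) auto

lemma integrable_weight_continuous:
  fixes U :: "(real ^ 'm) set" and f :: "real ^ 'm \<Rightarrow> real"
  assumes V: "V \<in> varifolds n U" "open U" "compact K" "K \<subseteq> U"
    and f: "continuous_on UNIV f" "\<And>x. x \<notin> K \<Longrightarrow> f x = 0"
  shows "integrable (weight U V) f"
proof -
  have "compact (f ` K)"
    using f V by (meson compact_continuous_image continuous_on_subset subset_UNIV)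
  then obtain B where "\<And>x. x \<in> K \<Longrightarrow> \<bar>f x\<bar> \<le> B"
    by (force dest!: compact_imp_bounded simp: bounded_iff)
  with V f show ?thesis
    by (intro integrable_weight_bounded[of V n U K f B] borel_measurable_weight
        borel_measurable_continuous_onI)
qed

lemma integrable_weight_Cc1:
  fixes U :: "(real ^ 'm) set" and f :: "real ^ 'm \<Rightarrow> real"
  assumes "V \<in> varifolds n U" "open U" "f \<in> Cc1 U"
  shows "integrable (weight U V) f"
  using assms notin_supp[of _ f]
  by (intro integrable_weight_continuous[of V n U "supp f"] cont_diff1_continuous) (auto simp: Cc1_def)

lemma integral_weight:
  fixes f :: "real ^ 'm \<Rightarrow> real"
  assumes V: "V \<in> varifolds n U" and f: "f \<in> borel_measurable (weight U V)"
  shows "integrable V (\<lambda>z. f (fst z)) \<longleftrightarrow> integrable (weight U V) f"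
    and "(LINT z|V. f (fst z)) = (LINT x|weight U V. f x)"
proof -
  have "f \<in> borel_measurable (restrict_space borel U)"
    using f measurable_cong_sets[OF sets_weight refl] by blast
  with measurable_fst_varifold(2)[OF V] show
    "integrable V (\<lambda>z. f (fst z)) \<longleftrightarrow> integrable (weight U V) f"
    "(LINT z|V. f (fst z)) = (LINT x|weight U V. f x)"
    unfolding weight_def by (auto simp: integrable_distr_eq integral_distr)
qed

text \<open>The mean curvature is measurable only for the completed weight, while the Brakke integral lives on
  the completed varifold. Pushing forward along \<open>fst\<close> commutes with completion because the null
  sets of the weight are, by definition, those whose preimage is null.\<close>
lemma integral_completion_weight:
  fixes f :: "real ^ 'm \<Rightarrow> real"
  assumes V: "V \<in> varifolds n U" and f: "f \<in> borel_measurable (completion (weight U V))"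
  shows "integrable (completion V) (\<lambda>z. f (fst z)) \<longleftrightarrow> integrable (completion (weight U V)) f"
    and "(LINT z|completion V. f (fst z)) = (LINT x|completion (weight U V). f x)"
proof -
  have m: "fst \<in> V \<rightarrow>\<^sub>M weight U V"
    using measurable_fst_varifold(2)[OF V] measurable_cong_sets[OF refl sets_weight] by blast
  have d: "distr (completion V) (weight U V) fst = weight U V"
    unfolding distr_completion[OF m] by (subst (2) weight_def) (intro distr_cong refl sets_weight)
  have mc: "fst \<in> completion V \<rightarrow>\<^sub>M completion (weight U V)"
    by (intro completion.measurable_completion2 measurable_completion m) (simp add: d)
  have eq: "distr (completion V) (completion (weight U V)) fst = completion (weight U V)"
    using completion.completion_distr_eq[OF measurable_completion[OF m]] by (simp add: d)
  show "integrable (completion V) (\<lambda>z. f (fst z)) \<longleftrightarrow> integrable (completion (weight U V)) f"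
    using integrable_distr_eq[OF mc f] by (simp add: eq)
  show "(LINT z|completion V. f (fst z)) = (LINT x|completion (weight U V). f x)"
    using integral_distr[OF mc f] by (simp add: eq)
qed

section \<open>The Brakke integral of a truncated power\<close>

text \<open>The derivative of a radial field is a multiple of the identity minus a rank one matrix; paired
  with a projection, the latter contributes the squared length of the tangential part of \<open>x - a\<close>.\<close>
lemma trace_jacobian_radial:
  fixes a :: "real ^ 'm" and A :: "real ^ 'm ^ 'm"
  assumes "p \<ge> 2"
  shows "trace (transpose (jacobian (\<lambda>x. bump p a r x *\<^sub>R (x - a)) (at x)) ** A)
    = bump p a r x * trace A - 2 * real p * bump (p - 1) a r x * ((x - a) \<bullet> (A *v (x - a)))"
proof -
  define y b c where "y = x - a" and "b = bump p a r x" and "c = 2 * real p * bump (p - 1) a r x"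
  have "((\<lambda>x. bump p a r x *\<^sub>R (x - a)) has_derivative
      (\<lambda>h. b *\<^sub>R h - (c * (h \<bullet> y)) *\<^sub>R y)) (at x)"
    by (rule has_derivative_eq_rhs[OF has_derivative_scaleR[OF bump_has_derivative[OF assms]]])
      (auto intro!: derivative_eq_intros simp: y_def b_def c_def)
  from frechet_derivative_at[OF this, symmetric]
  have J: "jacobian (\<lambda>x. bump p a r x *\<^sub>R (x - a)) (at x)
      = (\<chi> i j. b * (if i = j then 1 else 0) - c * (y $ j) * y $ i)"
    by (simp add: jacobian_def matrix_def vec_eq_iff inner_axis') (simp add: axis_def)
  have "trace (transpose (jacobian (\<lambda>x. bump p a r x *\<^sub>R (x - a)) (at x)) ** A)
      = (\<Sum>i\<in>UNIV. \<Sum>k\<in>UNIV. b * ((if k = i then 1 else 0) * A $ k $ i) - c * (y $ k * (A $ k $ i * y $ i)))"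
    unfolding J by (simp add: trace_def transpose_def matrix_matrix_mult_def algebra_simps)
  also have "\<dots> = b * trace A - c * (\<Sum>i\<in>UNIV. \<Sum>k\<in>UNIV. y $ k * (A $ k $ i * y $ i))"
    by (simp add: sum_subtractf sum_distrib_left trace_def if_distrib[where f = "\<lambda>u. u * _"]
        if_distrib[where f = "\<lambda>u. b * u"] cong: if_cong)
  also have "(\<Sum>i\<in>UNIV. \<Sum>k\<in>UNIV. y $ k * (A $ k $ i * y $ i)) = y \<bullet> (A *v y)"
    by (subst sum.swap) (simp add: inner_vec_def matrix_vector_mult_def sum_distrib_left)
  finally show ?thesis by (simp add: y_def b_def c_def)
qed

text \<open>Here \<open>\<psi>\<close> is the value of \<open>r - (norm y)\<^sup>2\<close>, so that \<open>-8\<psi>\<^sup>3 y\<close> is the gradient of \<open>\<psi>\<^sup>4\<close>. The mean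
  curvature \<open>H\<close> of a general varifold has a tangential part, so replacing the normal part of the
  gradient by the full gradient in the product with \<open>H\<close> produces an error. It is absorbed by half
  of the good term \<open>\<psi>\<^sup>4 |H|\<^sup>2\<close> at the price of \<open>32 \<psi>\<^sup>2\<close> times the squared tangential part of \<open>y\<close>. The
  other half absorbs the product of \<open>H\<close> with the velocity \<open>u\<close>.\<close>
lemma brakke_integrand_le:
  fixes y H u :: "real ^ 'm"
  assumes S: "subspace S" and \<psi>: "0 \<le> \<psi>" "\<psi> \<le> R\<^sup>2" and y: "norm y \<le> R"
  shows "(orth_proj (S\<^sup>\<bottom>) ((- (8 * \<psi> ^ 3)) *\<^sub>R y) - \<psi> ^ 4 *\<^sub>R H) \<bullet> (H + orth_proj (S\<^sup>\<bottom>) u)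
    \<le> - 8 * (\<psi> ^ 3 * (y \<bullet> H)) + 32 * (\<psi>\<^sup>2 * (y \<bullet> orth_proj S y))
       + (4 * R + R\<^sup>2 / 2) * (\<psi> ^ 3 * (1 + (norm u)\<^sup>2))"
proof -
  define v where "v = u - orth_proj S u"
  define q where "q = orth_proj S y"
  have R: "0 \<le> R" using y norm_ge_zero[of y] by linarith
  have nv: "norm v \<le> norm u"
    unfolding v_def by (rule norm_orth_comp_le[OF S])
  have ny: "norm (y - q) \<le> R"
    using norm_orth_comp_le[OF S, of y] y by (simp add: q_def)
  have yq: "y \<bullet> q = q \<bullet> q"
    using inner_orth_proj[OF S, of y y] by (simp add: q_def inner_commute)
  have lin: "orth_proj (S\<^sup>\<bottom>) ((- (8 * \<psi> ^ 3)) *\<^sub>R y) = (- (8 * \<psi> ^ 3)) *\<^sub>R (y - q)"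
    unfolding orth_proj_comp[OF S] linear_cmul[OF linear_orth_proj[OF S]] q_def
    by (simp add: scaleR_diff_right)
  have 1: "8 * \<psi> ^ 3 * (q \<bullet> H) \<le> 32 * \<psi>\<^sup>2 * (q \<bullet> q) + \<psi> ^ 4 * (H \<bullet> H) / 2"
  proof -
    (* The coefficients balance so that q and H carry the same power of psi in the cross term. *)
    have "0 \<le> ((8 * \<psi>) *\<^sub>R q - \<psi>\<^sup>2 *\<^sub>R H) \<bullet> ((8 * \<psi>) *\<^sub>R q - \<psi>\<^sup>2 *\<^sub>R H)" by simp
    then show ?thesis
      by (simp add: inner_diff_left inner_diff_right inner_commute power2_eq_square
          power3_eq_cube power4_eq_xxxx algebra_simps)
  qed
  have 2: "- (\<psi> ^ 4 * (H \<bullet> v)) \<le> \<psi> ^ 4 * (H \<bullet> H) / 2 + R\<^sup>2 / 2 * (\<psi> ^ 3 * (norm u)\<^sup>2)"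
  proof -
    have "0 \<le> \<psi> ^ 4 * ((H + v) \<bullet> (H + v))" using \<psi> by simp
    then have "- (\<psi> ^ 4 * (H \<bullet> v)) \<le> \<psi> ^ 4 * (H \<bullet> H) / 2 + \<psi> ^ 4 * (norm v)\<^sup>2 / 2"
      by (simp add: inner_add_left inner_add_right inner_commute power2_norm_eq_inner algebra_simps)
    moreover have "\<psi> ^ 4 * (norm v)\<^sup>2 \<le> (R\<^sup>2 * \<psi> ^ 3) * (norm u)\<^sup>2"
      using \<psi> nv mult_right_mono[of \<psi> "R\<^sup>2" "\<psi> ^ 3"]
      by (intro mult_mono power_mono) (auto simp: power4_eq_xxxx power3_eq_cube mult.assoc)
    ultimately show ?thesis by (simp add: algebra_simps)
  qed
  have 3: "- (8 * \<psi> ^ 3 * ((y - q) \<bullet> v)) \<le> 4 * R * (\<psi> ^ 3 * (1 + (norm u)\<^sup>2))"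
  proof -
    have "\<bar>(y - q) \<bullet> v\<bar> \<le> norm (y - q) * norm v" by (rule Cauchy_Schwarz_ineq2)
    also have "\<dots> \<le> R * norm u" using ny nv R by (intro mult_mono) auto
    finally have "- ((y - q) \<bullet> v) \<le> R * norm u" by linarith
    moreover have "2 * norm u \<le> 1 + (norm u)\<^sup>2"
      using zero_le_power2[of "norm u - 1"] by (simp add: power2_diff)
    then have "2 * (R * norm u) \<le> R * (1 + (norm u)\<^sup>2)"
      using mult_left_mono[OF _ R] by (metis mult.left_commute)
    ultimately have "- (2 * ((y - q) \<bullet> v)) \<le> R * (1 + (norm u)\<^sup>2)" by linarith
    then have "(4 * \<psi> ^ 3) * (- (2 * ((y - q) \<bullet> v))) \<le> (4 * \<psi> ^ 3) * (R * (1 + (norm u)\<^sup>2))"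
      using \<psi> by (intro mult_left_mono) auto
    then show ?thesis by (simp add: algebra_simps)
  qed
  have "(orth_proj (S\<^sup>\<bottom>) ((- (8 * \<psi> ^ 3)) *\<^sub>R y) - \<psi> ^ 4 *\<^sub>R H) \<bullet> (H + orth_proj (S\<^sup>\<bottom>) u)
    = - 8 * (\<psi> ^ 3 * (y \<bullet> H)) + 8 * \<psi> ^ 3 * (q \<bullet> H) - \<psi> ^ 4 * (H \<bullet> H)
      - 8 * \<psi> ^ 3 * ((y - q) \<bullet> v) - \<psi> ^ 4 * (H \<bullet> v)"
    unfolding lin orth_proj_comp[OF S, of u] v_def[symmetric]
    by (simp add: inner_diff_left inner_add_right algebra_simps)
  also have "\<dots> \<le> - 8 * (\<psi> ^ 3 * (y \<bullet> H)) + 32 * (\<psi>\<^sup>2 * (q \<bullet> q)) + R\<^sup>2 / 2 * (\<psi> ^ 3 * (norm u)\<^sup>2)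
      + 4 * R * (\<psi> ^ 3 * (1 + (norm u)\<^sup>2))"
    using 1 2 3 by linarith
  also have "\<dots> \<le> - 8 * (\<psi> ^ 3 * (y \<bullet> H)) + 32 * (\<psi>\<^sup>2 * (q \<bullet> q)) + R\<^sup>2 / 2 * (\<psi> ^ 3 * (1 + (norm u)\<^sup>2))
      + 4 * R * (\<psi> ^ 3 * (1 + (norm u)\<^sup>2))"
    using \<psi> mult_left_mono[of "\<psi> ^ 3 * (norm u)\<^sup>2" "\<psi> ^ 3 * (1 + (norm u)\<^sup>2)" "R\<^sup>2 / 2"]
    by (simp add: algebra_simps)
  finally show ?thesis
    unfolding q_def[symmetric] yq by (simp add: algebra_simps)
qed

lemma bump_pow: "bump p a r x = bump (Suc 0) a r x ^ p"
  by (simp add: bump_def)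

text \<open>The squared length of the orthogonal projection of \<open>x - a\<close> to \<open>S\<close>, for \<open>z = (x, S)\<close>. The matrix form
  makes its measurability evident, since the topology on subspaces comes from these matrices.\<close>
definition tangential_sq :: "real ^ 'm \<Rightarrow> (real ^ 'm) \<times> (real ^ 'm) set \<Rightarrow> real" where
  "tangential_sq a z = (fst z - a) \<bullet> (matrix (orth_proj (snd z)) *v (fst z - a))"

lemma tangential_term:
  fixes a :: "real ^ 'm"
  assumes V: "V \<in> varifolds n U" and U: "open U" "cball a R \<subseteq> U" and r: "0 \<le> r" "r \<le> R\<^sup>2" "0 \<le> R" "p \<ge> 1"
  shows "(\<lambda>z. bump p a r (fst z) * tangential_sq a z) \<in> borel_measurable V"
    and "z \<in> space V \<Longrightarrow> bump p a r (fst z) * tangential_sq a z \<le> r ^ p * R\<^sup>2 * indicator (cball a R) (fst z)"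
    and "z \<in> space V \<Longrightarrow> 0 \<le> bump p a r (fst z) * tangential_sq a z"
    and "integrable V (\<lambda>z. bump p a r (fst z) * tangential_sq a z)"
    and "integrable V (\<lambda>z. c * indicator (cball a R) (fst z) :: real)"
proof -
  let ?f = "\<lambda>z. bump p a r (fst z) * tangential_sq a z"
  note m1 = measurable_fst_varifold(1)[OF V]
  have x: "(\<lambda>z. fst z $ i) \<in> borel_measurable V" for i
    by (rule borel_measurable_continuous_on[OF _ m1]) (intro continuous_intros)
  have P: "(\<lambda>z. matrix (orth_proj (snd z)) $ i $ j) \<in> borel_measurable V" for i j
    by (rule borel_measurable_continuous_on[OF _ measurable_orth_proj_varifold[OF V]])
      (intro continuous_intros)
  show m: "?f \<in> borel_measurable V"
    unfolding tangential_sq_def inner_vec_def matrix_vector_mult_def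
    by (simp, intro borel_measurable_times borel_measurable_sum borel_measurable_diff
        borel_measurable_const x P borel_measurable_continuous_on[OF continuous_bump m1])
  have S: "subspace (snd z)" if "z \<in> space V" for z
    using that by (auto simp: space_varifold[OF V] grassmannian_def)
  have q: "0 \<le> tangential_sq a z"
    "tangential_sq a z \<le> (norm (fst z - a))\<^sup>2" if "z \<in> space V" for z
  proof -
    note S[OF that]
    then have *: "tangential_sq a z
        = (norm (orth_proj (snd z) (fst z - a)))\<^sup>2"
      using inner_orth_proj[of "snd z" "fst z - a" "fst z - a"]
      by (simp add: tangential_sq_def matrix_orth_proj_mult power2_norm_eq_inner inner_commute)
    show "0 \<le> tangential_sq a z"
      "tangential_sq a z \<le> (norm (fst z - a))\<^sup>2"
      unfolding * using norm_orth_proj_le[OF S[OF that]] by (auto intro: power_mono)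
  qed
  show nn: "0 \<le> ?f z" if "z \<in> space V" for z
    using q(1)[OF that] by (intro mult_nonneg_nonneg bump_nonneg)
  show le: "?f z \<le> r ^ p * R\<^sup>2 * indicator (cball a R) (fst z)" if "z \<in> space V" for z
  proof (cases "fst z \<in> cball a R")
    case True
    then have "(norm (fst z - a))\<^sup>2 \<le> R\<^sup>2"
      by (intro power_mono) (auto simp: dist_norm norm_minus_commute)
    with q(2)[OF that] have "tangential_sq a z \<le> R\<^sup>2" by linarith
    with True q(1)[OF that] r show ?thesis
      by (auto intro!: mult_mono bump_le)
  next
    case False
    then show ?thesis using bump_eq_0[of p r R "fst z" a] r by simp
  qed
  show i: "integrable V (\<lambda>z. c * indicator (cball a R) (fst z) :: real)" for c
  proof -
    have m: "(\<lambda>x. c * indicator (cball a R) x :: real) \<in> borel_measurable (weight U V)"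
      by (intro borel_measurable_weight borel_measurable_times borel_measurable_const
          borel_measurable_indicator) auto
    have "integrable (weight U V) (\<lambda>x. c * indicator (cball a R) x)"
      by (rule integrable_weight_bounded[OF V U(1) compact_cball U(2) m, of "\<bar>c\<bar>"]) auto
    then show ?thesis
      using integral_weight(1)[OF V m] by simp
  qed
  show "integrable V ?f"
  proof (rule Bochner_Integration.integrable_bound[OF i m])
    show "AE z in V. norm (?f z) \<le> norm (r ^ p * R\<^sup>2 * indicator (cball a R) (fst z) :: real)"
    proof (rule AE_I2)
      fix z assume "z \<in> space V"
      from nn[OF this] le[OF this]
      show "norm (?f z) \<le> norm (r ^ p * R\<^sup>2 * indicator (cball a R) (fst z) :: real)"
        unfolding real_norm_def by linarith
    qed
  qed
qed

text \<open>Up to the factor \<open>-8\<close>, this is the defining identity of the mean curvature for the gradient of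
  \<open>bump 4 a r\<close>. That gradient is supported in the closed ball, not in a compact subset of
  the open ball where \<open>H\<close> is given, so it is not an admissible test field; the gradients for smaller
  parameters \<open>\<rho> j\<close> are, and dominated convergence gives the limit.\<close>
lemma first_variation_bump:
  fixes a :: "real ^ 'm"
  assumes V: "V \<in> varifolds n U" and U: "open U" "cball a R \<subseteq> U" and r: "0 < r" "r \<le> R\<^sup>2" "0 \<le> R"
    and H: "gen_mean_curvature U V {x. (norm (x - a))\<^sup>2 < r} H"
    and Hi: "set_integrable (completion (weight U V)) {x. (norm (x - a))\<^sup>2 < r} H"
  shows "real n * (LINT x|weight U V. bump 3 a r x)
      - 6 * (LINT z|V. bump 2 a r (fst z) * tangential_sq a z)
    = - (LINT x|completion (weight U V). bump 3 a r x * ((x - a) \<bullet> H x))"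
    and "integrable (completion (weight U V)) (\<lambda>x. bump 3 a r x * ((x - a) \<bullet> H x))"
proof -
  let ?W = "weight U V" and ?\<Omega> = "{x. (norm (x - a))\<^sup>2 < r}"
  define T where "T p r z = bump p a r (fst z) * tangential_sq a z" for p r and z :: "(real ^ 'm) \<times> (real ^ 'm) set"
  define H0 where "H0 x = indicator ?\<Omega> x *\<^sub>R H x" for x
  have H0: "integrable (completion ?W) H0"
    using Hi by (simp add: set_integrable_def H0_def[abs_def])
  have [measurable]: "H0 \<in> borel_measurable (completion ?W)" using H0 by auto
  have bm[measurable]: "bump p a \<rho> \<in> borel_measurable borel" for p \<rho>
    by (intro borel_measurable_continuous_onI continuous_bump)
  have bV[measurable]: "(\<lambda>z. bump p a \<rho> (fst z)) \<in> borel_measurable V" for p \<rho>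
    by (rule borel_measurable_continuous_on[OF continuous_bump measurable_fst_varifold(1)[OF V]])
  have S: "subspace (snd z)" "dim (snd z) = n" if "z \<in> space V" for z
    using that by (auto simp: space_varifold[OF V] grassmannian_def)
  have bH: "bump 3 a \<rho> x * ((x - a) \<bullet> H x) = bump 3 a \<rho> x * ((x - a) \<bullet> H0 x)" if "\<rho> \<le> r" for \<rho> x
    using that by (auto simp: H0_def bump_def indicator_def)
  have Hm: "(\<lambda>x. bump 3 a \<rho> x * ((x - a) \<bullet> H0 x)) \<in> borel_measurable (completion ?W)" for \<rho>
  proof -
    have [measurable]: "(\<lambda>x. bump 3 a \<rho> x) \<in> borel_measurable (completion ?W)" "(\<lambda>x. x - a) \<in> borel_measurable (completion ?W)"
      by (auto intro!: measurable_completion borel_measurable_weight)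
    show ?thesis by measurable
  qed
  have Hb: "norm (bump 3 a \<rho> x * ((x - a) \<bullet> H0 x)) \<le> r ^ 3 * R * norm (H0 x)" if "\<rho> \<le> r" for \<rho> x
  proof (cases "x \<in> cball a R")
    case True
    then have "norm (x - a) \<le> R" by (simp add: dist_norm norm_minus_commute)
    have "\<bar>(x - a) \<bullet> H0 x\<bar> \<le> norm (x - a) * norm (H0 x)" by (rule Cauchy_Schwarz_ineq2)
    also have "\<dots> \<le> R * norm (H0 x)" using \<open>norm (x - a) \<le> R\<close> by (intro mult_right_mono) auto
    finally have "bump 3 a \<rho> x * \<bar>(x - a) \<bullet> H0 x\<bar> \<le> r ^ 3 * (R * norm (H0 x))"
      using r bump_mono[OF that, of 3 a x] bump_le[of r 3 a x] by (intro mult_mono bump_nonneg) auto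
    then show ?thesis by (simp add: abs_mult bump_nonneg mult.assoc)
  next
    case False
    then show ?thesis using bump_eq_0[of 3 \<rho> R x a] r that by simp
  qed
  define \<rho> where "\<rho> j = r - r / real (j + 2)" for j :: nat
  have \<rho>: "0 < \<rho> j" "\<rho> j < r" for j
    using r by (auto simp: \<rho>_def field_simps intro!: add_pos_nonneg)
  have \<rho>lim: "\<rho> \<longlonglongrightarrow> r"
  proof -
    have "(\<lambda>j. r / real (j + 2)) \<longlonglongrightarrow> 0"
      using LIMSEQ_ignore_initial_segment[OF lim_const_over_n, of r 2] by simp
    from tendsto_diff[OF tendsto_const this, of r] show ?thesis by (simp add: \<rho>_def[abs_def])
  qed
  have blim: "(\<lambda>j. bump p a (\<rho> j) x) \<longlonglongrightarrow> bump p a r x" for p x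
    unfolding bump_def by (intro tendsto_intros \<rho>lim)
  have ident: "(LINT z|V. real n * bump 3 a (\<rho> j) (fst z) - 6 * T 2 (\<rho> j) z)
      = - (LINT x|completion ?W. bump 3 a (\<rho> j) x * ((x - a) \<bullet> H0 x))" for j
  proof -
    let ?\<Psi> = "\<lambda>x. bump 3 a (\<rho> j) x *\<^sub>R (x - a)"
    have "?\<Psi> \<in> Cc1 ?\<Omega>"
    proof (rule Cc1I[where K = "cball a (sqrt (\<rho> j))"])
      show "cont_diff1 ?\<Psi>"
        using cont_diff1_affine[OF bounded_linear_ident, of a] by (intro cont_diff1_scaleR cont_diff1_bump) auto
      show "cball a (sqrt (\<rho> j)) \<subseteq> ?\<Omega>"
      proof
        fix x assume "x \<in> cball a (sqrt (\<rho> j))"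
        then have "norm (x - a) \<le> sqrt (\<rho> j)" by (simp add: dist_norm norm_minus_commute)
        then have "(norm (x - a))\<^sup>2 \<le> (sqrt (\<rho> j))\<^sup>2" by (intro power_mono) auto
        then show "x \<in> ?\<Omega>" using \<rho>[of j] by simp
      qed
      show "?\<Psi> x = 0" if "x \<notin> cball a (sqrt (\<rho> j))" for x
        using bump_eq_0[OF _ _ _ that, of 3 "\<rho> j"] \<rho>[of j] by simp
    qed auto
    with H have "(LINT z|V. trace (transpose (jacobian ?\<Psi> (at (fst z))) ** matrix (orth_proj (snd z))))
        = - (LINT x|completion ?W. ?\<Psi> x \<bullet> H x)"
      unfolding gen_mean_curvature_def by (simp add: case_prod_beta')
    also have "(LINT x|completion ?W. ?\<Psi> x \<bullet> H x)
        = (LINT x|completion ?W. bump 3 a (\<rho> j) x * ((x - a) \<bullet> H0 x))"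
      using bH[of "\<rho> j"] \<rho>[of j] by (intro Bochner_Integration.integral_cong) auto
    also have "(LINT z|V. trace (transpose (jacobian ?\<Psi> (at (fst z))) ** matrix (orth_proj (snd z))))
        = (LINT z|V. real n * bump 3 a (\<rho> j) (fst z) - 6 * T 2 (\<rho> j) z)"
      using S by (intro Bochner_Integration.integral_cong)
        (auto simp: trace_jacobian_radial trace_orth_proj T_def tangential_sq_def)
    finally show ?thesis .
  qed
  have Tm: "T 2 \<rho>' \<in> borel_measurable V" if "0 \<le> \<rho>'" "\<rho>' \<le> r" for \<rho>'
    unfolding T_def using that r by (intro tangential_term(1)[OF V U]) auto
  have lim1: "(\<lambda>j. LINT z|V. real n * bump 3 a (\<rho> j) (fst z) - 6 * T 2 (\<rho> j) z)
      \<longlonglongrightarrow> (LINT z|V. real n * bump 3 a r (fst z) - 6 * T 2 r z)"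
  proof (rule integral_dominated_convergence)
    show "integrable V (\<lambda>z. (real n * r ^ 3 + 6 * (r\<^sup>2 * R\<^sup>2)) * indicator (cball a R) (fst z))"
      using r by (intro tangential_term(5)[OF V U, where p = 2 and r = r]) auto
    show "AE z in V. (\<lambda>j. real n * bump 3 a (\<rho> j) (fst z) - 6 * T 2 (\<rho> j) z)
        \<longlonglongrightarrow> real n * bump 3 a r (fst z) - 6 * T 2 r z"
      unfolding T_def by (intro always_eventually allI tendsto_intros blim)
    show "(\<lambda>z. real n * bump 3 a r (fst z) - 6 * T 2 r z) \<in> borel_measurable V"
      using Tm[of r] r by (intro borel_measurable_diff borel_measurable_times borel_measurable_const bV) auto
    show "(\<lambda>z. real n * bump 3 a (\<rho> j) (fst z) - 6 * T 2 (\<rho> j) z) \<in> borel_measurable V" for j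
      using Tm[of "\<rho> j"] \<rho>[of j]
      by (intro borel_measurable_diff borel_measurable_times borel_measurable_const bV) auto
    show "AE z in V. norm (real n * bump 3 a (\<rho> j) (fst z) - 6 * T 2 (\<rho> j) z)
        \<le> (real n * r ^ 3 + 6 * (r\<^sup>2 * R\<^sup>2)) * indicator (cball a R) (fst z)" for j
    proof (rule AE_I2)
      fix z assume z: "z \<in> space V"
      have rj: "0 \<le> \<rho> j" "\<rho> j \<le> R\<^sup>2" "\<rho> j \<le> r" using \<rho>[of j] r by auto
      have "0 \<le> T 2 (\<rho> j) z" "T 2 (\<rho> j) z \<le> (\<rho> j)\<^sup>2 * R\<^sup>2 * indicator (cball a R) (fst z)"
        unfolding T_def using tangential_term(2,3)[OF V U rj(1,2) r(3) _ z, of 2] by auto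
      moreover have "(\<rho> j)\<^sup>2 * R\<^sup>2 * indicator (cball a R) (fst z) \<le> r\<^sup>2 * R\<^sup>2 * indicator (cball a R) (fst z)"
        using rj by (intro mult_right_mono power_mono) auto
      moreover have "bump 3 a (\<rho> j) (fst z) \<le> r ^ 3 * indicator (cball a R) (fst z)"
        using bump_mono[OF rj(3), of 3 a "fst z"] bump_le[of r 3 a "fst z"] bump_eq_0[of 3 "\<rho> j" R "fst z" a] rj r
        by (auto simp: indicator_def)
      then have "real n * bump 3 a (\<rho> j) (fst z) \<le> real n * (r ^ 3 * indicator (cball a R) (fst z))"
        by (intro mult_left_mono) auto
      moreover have "0 \<le> real n * bump 3 a (\<rho> j) (fst z)"
        by (intro mult_nonneg_nonneg bump_nonneg) auto
      ultimately show "norm (real n * bump 3 a (\<rho> j) (fst z) - 6 * T 2 (\<rho> j) z)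
        \<le> (real n * r ^ 3 + 6 * (r\<^sup>2 * R\<^sup>2)) * indicator (cball a R) (fst z)"
        unfolding real_norm_def abs_le_iff distrib_right mult.assoc[of 6] mult.assoc[of "real n"]
        by (intro conjI; linarith)
    qed
  qed
  have lim2: "(\<lambda>j. LINT x|completion ?W. bump 3 a (\<rho> j) x * ((x - a) \<bullet> H0 x))
      \<longlonglongrightarrow> (LINT x|completion ?W. bump 3 a r x * ((x - a) \<bullet> H0 x))"
  proof (rule integral_dominated_convergence)
    show "integrable (completion ?W) (\<lambda>x. r ^ 3 * R * norm (H0 x))"
      using H0 by auto
    show "AE x in completion ?W. (\<lambda>j. bump 3 a (\<rho> j) x * ((x - a) \<bullet> H0 x))
        \<longlonglongrightarrow> bump 3 a r x * ((x - a) \<bullet> H0 x)"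
      by (intro AE_I2 tendsto_intros blim)
    show "AE x in completion ?W. norm (bump 3 a (\<rho> j) x * ((x - a) \<bullet> H0 x)) \<le> r ^ 3 * R * norm (H0 x)" for j
      using \<rho>(2)[of j] by (intro AE_I2 Hb) auto
  qed (rule Hm)+
  have lim: "(LINT z|V. real n * bump 3 a r (fst z) - 6 * T 2 r z)
      = - (LINT x|completion ?W. bump 3 a r x * ((x - a) \<bullet> H0 x))"
    by (rule LIMSEQ_unique[OF lim1[unfolded ident] tendsto_minus[OF lim2]])
  have "integrable ?W (bump 3 a r)"
    using r by (intro integrable_weight_continuous[OF V U(1) _ U(2)] continuous_bump bump_eq_0[where R = R]) auto
  moreover from this have "integrable V (\<lambda>z. bump 3 a r (fst z))"
    by (subst integral_weight(1)[OF V]) auto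
  moreover have "integrable V (T 2 r)"
    unfolding T_def using r by (intro tangential_term(4)[OF V U]) auto
  ultimately have "(LINT z|V. real n * bump 3 a r (fst z) - 6 * T 2 r z)
      = real n * (LINT x|?W. bump 3 a r x) - 6 * (LINT z|V. T 2 r z)"
    using integral_weight(2)[OF V, of "bump 3 a r"] by simp
  with lim show "real n * (LINT x|?W. bump 3 a r x)
      - 6 * (LINT z|V. bump 2 a r (fst z) * tangential_sq a z)
    = - (LINT x|completion ?W. bump 3 a r x * ((x - a) \<bullet> H x))"
    unfolding bH[OF order_refl] T_def by simp
  show "integrable (completion ?W) (\<lambda>x. bump 3 a r x * ((x - a) \<bullet> H x))"
    unfolding bH[OF order_refl]
    by (rule Bochner_Integration.integrable_bound[OF _ Hm, of "\<lambda>x. r ^ 3 * R * norm (H0 x)"])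
      (use H0 Hb r in \<open>auto intro!: AE_I2\<close>)
qed

text \<open>After integration, the first variation identity replaces the term linear in \<open>H\<close> of the pointwise
  bound by \<open>8 n \<psi>\<^sup>3 - 48 \<psi>\<^sup>2 |Sy|\<^sup>2\<close>, where \<open>Sy\<close> is the tangential part of \<open>x - a\<close>. The negative term exceeds
  the \<open>32 \<psi>\<^sup>2 |Sy|\<^sup>2\<close> lost there, and only multiples of \<open>\<psi>\<^sup>3\<close> remain. Nothing better than \<open>\<psi>\<^sup>3\<close> can be
  expected on the right, so this does not close up to a Gronwall estimate for \<open>\<psi>\<^sup>4\<close>.\<close>
lemma brakke_integral_bump_le:
  fixes a :: "real ^ 'm"
  assumes V: "V \<in> varifolds n U" and U: "open U" "cball a R \<subseteq> U" and r: "0 < r" "r \<le> R\<^sup>2" "0 \<le> R"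
    and adm: "brakke_admissible U V (bump 4 a r) f H"
  shows "integrable (completion (weight U V)) (\<lambda>x. bump 3 a r x * (norm (f x))\<^sup>2)"
    and "brakke_integral V (bump 4 a r) f H \<le>
      (8 * real n + 4 * R + R\<^sup>2 / 2) * (LINT x|weight U V. bump 3 a r x)
      + (4 * R + R\<^sup>2 / 2) * (LINT x|completion (weight U V). bump 3 a r x * (norm (f x))\<^sup>2)"
proof -
  let ?W = "weight U V" and ?\<Omega> = "{x. (norm (x - a))\<^sup>2 < r}"
  define C where "C = 4 * R + R\<^sup>2 / 2"
  have C: "0 \<le> C" using r by (simp add: C_def)
  have \<Omega>: "{x. 0 < bump 4 a r x} = ?\<Omega>" by (simp add: bump_pos_iff)
  have mc: "gen_mean_curvature U V ?\<Omega> H"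
    and f2: "square_integrable_on (completion ?W) ?\<Omega> f"
    and H2: "square_integrable_on (completion ?W) ?\<Omega> H"
    using adm unfolding brakke_admissible_def \<Omega> by blast+
  have \<Omega>R: "?\<Omega> \<subseteq> cball a R"
  proof
    fix x assume "x \<in> ?\<Omega>"
    then have "(norm (x - a))\<^sup>2 < r" by blast
    from order_trans[OF less_imp_le[OF this] r(2)] have "(norm (x - a))\<^sup>2 \<le> R\<^sup>2" .
    from power2_le_imp_le[OF this r(3)] have "norm (x - a) \<le> R" .
    then show "x \<in> cball a R" by (simp add: dist_norm norm_minus_commute)
  qed
  have \<Omega>s: "?\<Omega> \<in> sets ?W"
  proof -
    have "open ?\<Omega>" by (intro open_Collect_less continuous_intros)
    then show ?thesis using U \<Omega>R by (auto simp: sets_weight sets_restrict_space_iff)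
  qed
  have i\<Omega>: "integrable ?W (indicator ?\<Omega> :: _ \<Rightarrow> real)"
    using \<Omega>s \<Omega>R by (intro integrable_weight_bounded[OF V U(1) compact_cball U(2), of _ 1]) (auto simp: indicator_def)
  have i\<Omega>c: "integrable (completion ?W) (indicator ?\<Omega> :: _ \<Rightarrow> real)"
    using integrable_completion[of "indicator ?\<Omega> :: _ \<Rightarrow> real" ?W] i\<Omega> by auto
  have Hi: "set_integrable (completion ?W) ?\<Omega> H"
    unfolding set_integrable_def
  proof (rule Bochner_Integration.integrable_bound)
    show "integrable (completion ?W) (\<lambda>x. indicator ?\<Omega> x + indicator ?\<Omega> x *\<^sub>R (norm (H x))\<^sup>2)"
      using i\<Omega>c H2 by (auto simp: square_integrable_on_def set_integrable_def)
    show "(\<lambda>x. indicator ?\<Omega> x *\<^sub>R H x) \<in> borel_measurable (completion ?W)"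
      using H2 by (auto simp: square_integrable_on_def set_borel_measurable_def)
    have "norm v \<le> 1 + (norm v)\<^sup>2" for v :: "real ^ 'm"
      using zero_le_power2[of "norm v - 1"] norm_ge_zero[of v] unfolding power2_diff power_one mult_1_right by linarith
    then show "AE x in completion ?W. norm (indicator ?\<Omega> x *\<^sub>R H x)
        \<le> norm (indicator ?\<Omega> x + indicator ?\<Omega> x *\<^sub>R (norm (H x))\<^sup>2)"
      by (intro AE_I2) (simp add: indicator_def)
  qed
  note fv = first_variation_bump[OF V U r mc Hi]
  have b0: "bump 3 a r x = 0" if "x \<notin> ?\<Omega>" for x
    using that by (simp add: bump_def)
  have bi: "integrable ?W (bump 3 a r)"
    using r by (intro integrable_weight_continuous[OF V U(1) compact_cball U(2)] continuous_bump
        bump_eq_0[where R = R]) auto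
  have bm: "bump 3 a r \<in> borel_measurable ?W" using bi by auto
  have bic: "integrable (completion ?W) (bump 3 a r)"
    using bi bm by (simp add: integrable_completion)
  show fi: "integrable (completion ?W) (\<lambda>x. bump 3 a r x * (norm (f x))\<^sup>2)"
  proof -
    have *: "bump 3 a r x * (norm (f x))\<^sup>2 = bump 3 a r x * (indicator ?\<Omega> x *\<^sub>R (norm (f x))\<^sup>2)" for x
      using b0[of x] by (auto simp: indicator_def)
    have fo: "integrable (completion ?W) (\<lambda>x. indicator ?\<Omega> x *\<^sub>R (norm (f x))\<^sup>2)"
      using f2 by (auto simp: square_integrable_on_def set_integrable_def)
    have m: "bump 3 a r \<in> borel_measurable (completion ?W)" using bic by auto
    show ?thesis
      unfolding *
    proof (rule Bochner_Integration.integrable_bound)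
      show "integrable (completion ?W) (\<lambda>x. r ^ 3 * (indicator ?\<Omega> x *\<^sub>R (norm (f x))\<^sup>2))"
        using fo by simp
      show "(\<lambda>x. bump 3 a r x * (indicator ?\<Omega> x *\<^sub>R (norm (f x))\<^sup>2)) \<in> borel_measurable (completion ?W)"
        using m fo by (intro borel_measurable_times) auto
      show "AE x in completion ?W. norm (bump 3 a r x * (indicator ?\<Omega> x *\<^sub>R (norm (f x))\<^sup>2))
          \<le> norm (r ^ 3 * (indicator ?\<Omega> x *\<^sub>R (norm (f x))\<^sup>2))"
        using r by (intro AE_I2) (auto simp: abs_mult bump_nonneg intro!: mult_right_mono bump_le)
    qed
  qed
  define T where "T z = bump 2 a r (fst z) * tangential_sq a z" for z
  have Ti: "integrable V T" and T0: "\<And>z. z \<in> space V \<Longrightarrow> 0 \<le> T z"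
    unfolding T_def using r by (auto intro!: tangential_term(4)[OF V U] tangential_term(3)[OF V U])
  have Tic: "integrable (completion V) T" and Tc: "(LINT z|completion V. T z) = (LINT z|V. T z)"
    using Ti by (auto simp: integrable_completion integral_completion)
  have "0 \<le> (LINT z|V. T z)"
    using T0 by (intro integral_nonneg_AE AE_I2)
  define G where "G z = - 8 * (bump 3 a r (fst z) * ((fst z - a) \<bullet> H (fst z))) + 32 * T z
      + C * (bump 3 a r (fst z) + bump 3 a r (fst z) * (norm (f (fst z)))\<^sup>2)" for z
  let ?I = "\<lambda>z. (orth_proj ((snd z)\<^sup>\<bottom>) (gradient (bump 4 a r) (fst z)) - bump 4 a r (fst z) *\<^sub>R H (fst z))
      \<bullet> (H (fst z) + orth_proj ((snd z)\<^sup>\<bottom>) (f (fst z)))"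
  have IG: "?I z \<le> G z" if "z \<in> space V" for z
  proof (cases "fst z \<in> cball a R")
    case True
    have S: "subspace (snd z)" using that by (auto simp: space_varifold[OF V] grassmannian_def)
    define \<psi> where "\<psi> = bump (Suc 0) a r (fst z)"
    have \<psi>: "bump p a r (fst z) = \<psi> ^ p" for p
      unfolding \<psi>_def by (rule bump_pow)
    have "0 \<le> \<psi>" "\<psi> \<le> R\<^sup>2"
      using bump_le[of r "Suc 0" a "fst z"] r bump_nonneg[of "Suc 0" a r "fst z"] by (auto simp: \<psi>_def)
    moreover have "norm (fst z - a) \<le> R" using True by (simp add: dist_norm norm_minus_commute)
    ultimately have "(orth_proj ((snd z)\<^sup>\<bottom>) ((- (8 * \<psi> ^ 3)) *\<^sub>R (fst z - a)) - \<psi> ^ 4 *\<^sub>R H (fst z))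
          \<bullet> (H (fst z) + orth_proj ((snd z)\<^sup>\<bottom>) (f (fst z)))
        \<le> - 8 * (\<psi> ^ 3 * ((fst z - a) \<bullet> H (fst z)))
          + 32 * (\<psi>\<^sup>2 * ((fst z - a) \<bullet> orth_proj (snd z) (fst z - a)))
          + (4 * R + R\<^sup>2 / 2) * (\<psi> ^ 3 * (1 + (norm (f (fst z)))\<^sup>2))"
      by (rule brakke_integrand_le[OF S])
    moreover have "gradient (bump 4 a r) (fst z) = (- (8 * \<psi> ^ 3)) *\<^sub>R (fst z - a)"
      by (simp add: gradient_bump \<psi>)
    moreover have "G z = - 8 * (\<psi> ^ 3 * ((fst z - a) \<bullet> H (fst z)))
        + 32 * (\<psi>\<^sup>2 * ((fst z - a) \<bullet> orth_proj (snd z) (fst z - a)))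
        + (4 * R + R\<^sup>2 / 2) * (\<psi> ^ 3 * (1 + (norm (f (fst z)))\<^sup>2))"
      by (simp add: G_def T_def C_def \<psi> tangential_sq_def matrix_orth_proj_mult[OF S] distrib_left)
    ultimately show ?thesis by (simp only: \<psi>)
  next
    case False
    then have "bump p a r (fst z) = 0" if "p \<ge> 1" for p
      using that r by (intro bump_eq_0[where R = R]) auto
    moreover have "subspace ((snd z)\<^sup>\<bottom>)" by (rule subspace_orthogonal_comp)
    ultimately show ?thesis
      by (simp add: G_def T_def gradient_bump linear_0[OF linear_orth_proj])
  qed
  note w = integral_completion_weight[OF V]
  have m1: "(\<lambda>x. bump 3 a r x * ((x - a) \<bullet> H x)) \<in> borel_measurable (completion ?W)"
    and m2: "bump 3 a r \<in> borel_measurable (completion ?W)"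
    and m3: "(\<lambda>x. bump 3 a r x * (norm (f x))\<^sup>2) \<in> borel_measurable (completion ?W)"
    using fv(2) bic fi by auto
  have int: "integrable (completion V) (\<lambda>z. bump 3 a r (fst z) * ((fst z - a) \<bullet> H (fst z)))"
     "integrable (completion V) (\<lambda>z. bump 3 a r (fst z))"
     "integrable (completion V) (\<lambda>z. bump 3 a r (fst z) * (norm (f (fst z)))\<^sup>2)"
    using w(1)[OF m1] w(1)[OF m2] w(1)[OF m3] fv(2) bic fi by auto
  have Gi: "integrable (completion V) G"
    unfolding G_def using int Tic by auto
  have "(LINT z|completion V. G z) =
      - 8 * (LINT x|completion ?W. bump 3 a r x * ((x - a) \<bullet> H x)) + 32 * (LINT z|V. T z)
      + C * ((LINT x|completion ?W. bump 3 a r x) + (LINT x|completion ?W. bump 3 a r x * (norm (f x))\<^sup>2))"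
    unfolding G_def using int Tic by (simp add: w(2)[OF m1] w(2)[OF m2] w(2)[OF m3] Tc)
  also have "\<dots> = 8 * real n * (LINT x|?W. bump 3 a r x) - 16 * (LINT z|V. T z)
      + C * ((LINT x|?W. bump 3 a r x) + (LINT x|completion ?W. bump 3 a r x * (norm (f x))\<^sup>2))"
    using fv(1) integral_completion[OF bm] by (simp add: T_def)
  also have "\<dots> \<le> (8 * real n + C) * (LINT x|?W. bump 3 a r x)
      + C * (LINT x|completion ?W. bump 3 a r x * (norm (f x))\<^sup>2)" (is "_ \<le> ?R")
    using \<open>0 \<le> (LINT z|V. T z)\<close> by (simp add: algebra_simps)
  finally have GR: "(LINT z|completion V. G z) \<le> ?R" .
  have R0: "0 \<le> ?R"
    using C by (intro add_nonneg_nonneg mult_nonneg_nonneg integral_nonneg_AE AE_I2) (auto simp: bump_nonneg)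
  have "brakke_integral V (bump 4 a r) f H = (LINT z|completion V. ?I z)"
    unfolding brakke_integral_def by (simp add: case_prod_beta')
  also have "\<dots> \<le> ?R"
  proof (cases "integrable (completion V) ?I")
    case True
    then have "(LINT z|completion V. ?I z) \<le> (LINT z|completion V. G z)"
      using IG by (intro integral_mono Gi) auto
    then show ?thesis using GR by linarith
  next
    (* The Bochner integral then has its default value 0. *)
    case False
    then show ?thesis using R0 by (simp add: not_integrable_integral_eq)
  qed
  finally show "brakke_integral V (bump 4 a r) f H \<le>
      (8 * real n + 4 * R + R\<^sup>2 / 2) * (LINT x|weight U V. bump 3 a r x)
      + (4 * R + R\<^sup>2 / 2) * (LINT x|completion (weight U V). bump 3 a r x * (norm (f x))\<^sup>2)"
    by (simp add: C_def algebra_simps)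
qed

section \<open>Upper limits, Dini derivatives and shrinking barriers\<close>

text \<open>For extended reals \<open>\<infinity> + (-\<infinity>) = \<infinity>\<close>, so subadditivity of the upper limit has no exceptional case.\<close>
lemma Limsup_add_vanishing_le:
  fixes f g e :: "'a \<Rightarrow> real"
  assumes "(e \<longlongrightarrow> 0) F"
  shows "Limsup F (\<lambda>x. ereal (f x + g x + e x)) \<le> Limsup F (\<lambda>x. ereal (f x)) + Limsup F (\<lambda>x. ereal (g x))"
    (is "_ \<le> ?A + ?B")
proof (cases "?A = \<infinity> \<or> ?B = \<infinity>")
  case True
  then show ?thesis by auto
next
  case False
  show ?thesis
  proof (rule dense_ge)
    fix y assume y: "?A + ?B < y"
    show "Limsup F (\<lambda>x. ereal (f x + g x + e x)) \<le> y"
    proof (cases y)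
      case (real y')
      have "\<exists>\<alpha> \<beta>. ?A < ereal \<alpha> \<and> ?B < ereal \<beta> \<and> \<alpha> + \<beta> < y'"
      proof (cases ?A)
        case A: (real \<alpha>')
        show ?thesis
        proof (cases ?B)
          case B: (real \<beta>')
          with A y real have "\<alpha>' + \<beta>' < y'" by simp
          with A B show ?thesis
            by (intro exI[of _ "\<alpha>' + (y' - \<alpha>' - \<beta>') / 3"] exI[of _ "\<beta>' + (y' - \<alpha>' - \<beta>') / 3"])
              (auto simp: field_simps)
        next
          case MInf
          with A show ?thesis
            by (intro exI[of _ "\<alpha>' + 1"] exI[of _ "y' - \<alpha>' - 2"]) auto
        qed (use False in auto)
      next
        case MInf
        from False obtain \<beta> where "?B < ereal \<beta>"
          using less_PInf_Ex_of_nat by (metis)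
        with MInf show ?thesis
          by (intro exI[of _ "y' - \<beta> - 1"] exI[of _ \<beta>]) auto
      qed (use False in auto)
      then obtain \<alpha> \<beta> where \<alpha>\<beta>: "?A < ereal \<alpha>" "?B < ereal \<beta>" "\<alpha> + \<beta> < y'" by blast
      have "\<forall>\<^sub>F x in F. e x < y' - \<alpha> - \<beta>"
        using order_tendstoD(2)[OF assms] \<alpha>\<beta>(3) by simp
      with Limsup_lessD[OF \<alpha>\<beta>(1)] Limsup_lessD[OF \<alpha>\<beta>(2)]
      have "\<forall>\<^sub>F x in F. ereal (f x + g x + e x) \<le> y"
        by eventually_elim (auto simp: real)
      then show ?thesis by (rule Limsup_bounded)
    qed (use y in auto)
  qed
qed

lemma upper_deriv_lessD:
  assumes "upper_deriv f I s < ereal c"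
  obtains d where "d > 0" "\<And>t. t \<in> I \<Longrightarrow> t \<noteq> s \<Longrightarrow> \<bar>t - s\<bar> < d \<Longrightarrow> (f t - f s) / (t - s) < c"
proof -
  have "\<forall>\<^sub>F t in at s within I. (f t - f s) / (t - s) < c"
    using Limsup_lessD[OF assms[unfolded upper_deriv_def]] by simp
  then show ?thesis
    using that unfolding eventually_at dist_real_def by blast
qed

text \<open>A one-sided derivative bound from the left propagates to the supremum of the times up to which
  the estimate holds; upper semicontinuity from the right lets one continue past that time.\<close>
lemma dini_bound:
  fixes f :: "real \<Rightarrow> real"
  assumes "a \<le> b" and "0 \<le> c"
    and left: "\<And>s \<epsilon>. a < s \<Longrightarrow> s \<le> b \<Longrightarrow> 0 < \<epsilon> \<Longrightarrow>
      \<exists>d>0. \<forall>t. a \<le> t \<and> s - d < t \<and> t < s \<longrightarrow> f s \<le> f t + (c + \<epsilon>) * (s - t)"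
    and right: "\<And>s \<epsilon>. a \<le> s \<Longrightarrow> s < b \<Longrightarrow> 0 < \<epsilon> \<Longrightarrow>
      \<exists>d>0. \<forall>t. s < t \<and> t < s + d \<and> t \<le> b \<longrightarrow> f t \<le> f s + \<epsilon>"
  shows "f b \<le> f a + c * (b - a)"
proof (rule field_le_epsilon)
  fix \<eta> :: real assume "0 < \<eta>"
  define \<epsilon> where "\<epsilon> = \<eta> / (1 + (b - a))"
  have \<epsilon>: "0 < \<epsilon>" "\<epsilon> * (1 + (b - a)) = \<eta>"
    using \<open>0 < \<eta>\<close> \<open>a \<le> b\<close> by (auto simp: \<epsilon>_def)
  define g where "g t = f t - (c + \<epsilon>) * (t - a)" for t
  have "g b \<le> f a + \<epsilon>"
  proof (rule ccontr)
    assume contra: "\<not> ?thesis"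
    define A where "A = {t \<in> {a..b}. f a + \<epsilon> < g t}"
    have "b \<in> A" using contra \<open>a \<le> b\<close> by (simp add: A_def)
    have bdd: "bdd_below A" by (rule bdd_belowI[of _ a]) (auto simp: A_def)
    (* The infimum of the times at which the estimate fails. *)
    define \<tau> where "\<tau> = Inf A"
    have lower: "\<tau> \<le> t" if "t \<in> A" for t
      unfolding \<tau>_def by (rule cInf_lower[OF that bdd])
    have "a \<le> \<tau>" unfolding \<tau>_def using \<open>b \<in> A\<close> by (intro cInf_greatest) (auto simp: A_def)
    have "\<tau> \<le> b" using lower \<open>b \<in> A\<close> by blast
    have g\<tau>: "g \<tau> < f a + \<epsilon>"
    proof (cases "\<tau> = a")
      case True
      then show ?thesis using \<epsilon> by (simp add: g_def)
    next
      case False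
      with \<open>a \<le> \<tau>\<close> have "a < \<tau>" by simp
      then obtain d where d: "d > 0"
        "\<And>t. a \<le> t \<Longrightarrow> \<tau> - d < t \<Longrightarrow> t < \<tau> \<Longrightarrow> f \<tau> \<le> f t + (c + \<epsilon> / 2) * (\<tau> - t)"
        using left[of \<tau> "\<epsilon> / 2"] \<epsilon> \<open>\<tau> \<le> b\<close> by auto
      define t where "t = max a (\<tau> - d / 2)"
      have t: "a \<le> t" "\<tau> - d < t" "t < \<tau>" using \<open>a < \<tau>\<close> \<open>d > 0\<close> by (auto simp: t_def)
      then have "t \<notin> A" using lower by force
      then have "g t \<le> f a + \<epsilon>" using t \<open>\<tau> \<le> b\<close> by (auto simp: A_def)
      have "0 < \<epsilon> / 2 * (\<tau> - t)" using \<epsilon> t by simp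
      moreover have "(c + \<epsilon>) * (\<tau> - a) = (c + \<epsilon>) * (t - a) + (c + \<epsilon> / 2) * (\<tau> - t) + \<epsilon> / 2 * (\<tau> - t)"
        by (simp add: field_simps)
      ultimately have "g \<tau> < g t" using d(2)[OF t] unfolding g_def by linarith
      with \<open>g t \<le> f a + \<epsilon>\<close> show ?thesis by simp
    qed
    then have "\<tau> \<notin> A" by (simp add: A_def)
    with \<open>b \<in> A\<close> \<open>\<tau> \<le> b\<close> have "\<tau> < b" by (cases "\<tau> = b") auto
    with right[of \<tau> "f a + \<epsilon> - g \<tau>"] g\<tau> \<open>a \<le> \<tau>\<close> obtain d where d: "d > 0"
      "\<And>t. \<tau> < t \<Longrightarrow> t < \<tau> + d \<Longrightarrow> t \<le> b \<Longrightarrow> f t \<le> f \<tau> + (f a + \<epsilon> - g \<tau>)" by auto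
    obtain t where t: "t \<in> A" "t < \<tau> + d"
      using cInf_lessD[of A "\<tau> + d"] \<open>b \<in> A\<close> \<open>d > 0\<close> by (auto simp: \<tau>_def)
    with lower \<open>\<tau> \<notin> A\<close> have "\<tau> < t" by (metis order_le_less)
    have "(c + \<epsilon>) * (\<tau> - a) \<le> (c + \<epsilon>) * (t - a)"
      using \<open>\<tau> < t\<close> \<epsilon> \<open>0 \<le> c\<close> by (intro mult_left_mono) auto
    with d(2)[of t] t \<open>\<tau> < t\<close> show False by (auto simp: A_def g_def)
  qed
  then have "f b \<le> f a + c * (b - a) + \<epsilon> * (1 + (b - a))"
    by (simp add: g_def algebra_simps)
  then show "f b \<le> f a + c * (b - a) + \<eta>" by (simp add: \<epsilon>)
qed

text \<open>Think of \<open>m3 r t\<close> and \<open>m4 r t\<close> as the integrals of \<open>bump 3 a r\<close> and \<open>bump 4 a r\<close> at time \<open>t\<close>. Along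
  the shrinking parameter \<open>r \<tau>\<close> the loss \<open>4 (\<Lambda> + 1) m3\<close> beats the growth \<open>\<Lambda> m3\<close>. To see this one
  compares \<open>s\<close> with earlier times \<open>\<tau>\<close> only: the loss then involves \<open>m3\<close> at time \<open>\<tau>\<close>, and an
  upper derivative other than \<open>\<infinity>\<close> gives \<open>m3 r \<tau> \<ge> m3 r s - C (s - \<tau>)\<close>. For later times the inequality would point
  the other way, but there monotonicity of the barrier gives upper semicontinuity. No bound on
  the masses before time \<open>s\<close> enters, so the argument is not circular.\<close>
lemma barrier_bound:
  fixes m3 m4 :: "real \<Rightarrow> real \<Rightarrow> real"
  assumes conv: "\<And>r h t. t \<in> I \<Longrightarrow> 0 \<le> h \<Longrightarrow> r + h \<le> \<rho> \<Longrightarrow> m4 r t + 4 * h * m3 r t \<le> m4 (r + h) t"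
    and nonneg: "\<And>r t. t \<in> I \<Longrightarrow> 0 \<le> m3 r t"
    and \<Lambda>: "0 \<le> \<Lambda>"
    and up4: "\<And>r s. s \<in> I \<Longrightarrow> 0 < r \<Longrightarrow> r \<le> \<rho> \<Longrightarrow> upper_deriv (m4 r) I s \<le> ereal (\<Lambda> * m3 r s + \<Lambda>)"
    and up3: "\<And>r s. s \<in> I \<Longrightarrow> 0 < r \<Longrightarrow> r \<le> \<rho> \<Longrightarrow> upper_deriv (m3 r) I s < \<infinity>"
    and t: "t0 \<le> t" "{t0..t} \<subseteq> I" "(\<Lambda> + 1) * (t - t0) < \<rho>"
  shows "m4 (\<rho> - (\<Lambda> + 1) * (t - t0)) t \<le> m4 \<rho> t0 + \<Lambda> * (t - t0)"
proof -
  define L where "L = \<Lambda> + 1"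
  have L: "0 < L" "\<Lambda> \<le> 4 * L" using \<Lambda> by (auto simp: L_def)
  define r where "r \<tau> = \<rho> - L * (\<tau> - t0)" for \<tau>
  have r: "0 < r \<tau>" "r \<tau> \<le> \<rho>" if "t0 \<le> \<tau>" "\<tau> \<le> t" for \<tau>
  proof -
    have "L * (\<tau> - t0) \<le> L * (t - t0)" using that L by (intro mult_left_mono) auto
    then show "0 < r \<tau>" using t(3) by (simp add: r_def L_def)
    show "r \<tau> \<le> \<rho>" using that L by (simp add: r_def)
  qed
  have rshift: "r \<tau> = r s + L * (s - \<tau>)" for \<tau> s by (simp add: r_def algebra_simps)
  have "m4 (r t) t \<le> m4 (r t0) t0 + \<Lambda> * (t - t0)"
  proof (rule dini_bound[where f = "\<lambda>\<tau>. m4 (r \<tau>) \<tau>", OF t(1) \<Lambda>])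
    fix s \<epsilon> :: real assume s: "t0 < s" "s \<le> t" and \<epsilon>: "0 < \<epsilon>"
    have sI: "s \<in> I" using s t by auto
    note rs = r[OF less_imp_le[OF s(1)] s(2)]
    have "upper_deriv (m4 (r s)) I s < ereal (\<Lambda> * m3 (r s) s + \<Lambda> + \<epsilon> / 2)"
      using up4[OF sI rs] by (rule le_less_trans) (use \<epsilon> in simp)
    from upper_deriv_lessD[OF this] obtain d1 where d1: "d1 > 0"
      "\<And>\<tau>. \<tau> \<in> I \<Longrightarrow> \<tau> \<noteq> s \<Longrightarrow> \<bar>\<tau> - s\<bar> < d1 \<Longrightarrow>
        (m4 (r s) \<tau> - m4 (r s) s) / (\<tau> - s) < \<Lambda> * m3 (r s) s + \<Lambda> + \<epsilon> / 2" by metis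
    obtain N :: nat where "upper_deriv (m3 (r s)) I s < ereal (real N)"
      using up3[OF sI rs] less_PInf_Ex_of_nat by (metis less_irrefl)
    from upper_deriv_lessD[OF this] obtain d2 where d2: "d2 > 0"
      "\<And>\<tau>. \<tau> \<in> I \<Longrightarrow> \<tau> \<noteq> s \<Longrightarrow> \<bar>\<tau> - s\<bar> < d2 \<Longrightarrow> (m3 (r s) \<tau> - m3 (r s) s) / (\<tau> - s) < real N"
      by metis
    define d where "d = min (min d1 d2) (\<epsilon> / (8 * L * (real N + 1)))"
    have "d > 0" using d1 d2 \<epsilon> L by (auto simp: d_def)
    moreover have "m4 (r s) s \<le> m4 (r \<tau>) \<tau> + (\<Lambda> + \<epsilon>) * (s - \<tau>)"
      if \<tau>: "t0 \<le> \<tau>" "s - d < \<tau>" "\<tau> < s" for \<tau>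
    proof -
      define h where "h = s - \<tau>"
      have h: "0 < h" "h < d" using \<tau> by (auto simp: h_def)
      have \<tau>I: "\<tau> \<in> I" using \<tau> s t by auto
      have ab: "\<bar>\<tau> - s\<bar> < d1" "\<bar>\<tau> - s\<bar> < d2" using \<tau> by (auto simp: d_def)
      have "(m4 (r s) \<tau> - m4 (r s) s) / (\<tau> - s) = (m4 (r s) s - m4 (r s) \<tau>) / h"
        using h(1) by (simp add: h_def field_simps)
      with d1(2)[OF \<tau>I _ ab(1)] \<tau> have "(m4 (r s) s - m4 (r s) \<tau>) / h < \<Lambda> * m3 (r s) s + \<Lambda> + \<epsilon> / 2"
        by simp
      then have 1: "m4 (r s) s - m4 (r s) \<tau> < (\<Lambda> * m3 (r s) s + \<Lambda> + \<epsilon> / 2) * h"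
        using h(1) by (simp add: pos_divide_less_eq)
      have "(m3 (r s) \<tau> - m3 (r s) s) / (\<tau> - s) = (m3 (r s) s - m3 (r s) \<tau>) / h"
        using h(1) by (simp add: h_def field_simps)
      with d2(2)[OF \<tau>I _ ab(2)] \<tau> have "(m3 (r s) s - m3 (r s) \<tau>) / h < real N"
        by simp
      then have "m3 (r s) s - m3 (r s) \<tau> < real N * h"
        using h(1) by (simp add: pos_divide_less_eq)
      then have "4 * L * (m3 (r s) s - m3 (r s) \<tau>) \<le> 4 * L * ((real N + 1) * h)"
        using h(1) L by (intro mult_left_mono) (auto simp: algebra_simps)
      also have "\<dots> \<le> \<epsilon> / 2"
      proof -
        have "h \<le> \<epsilon> / (8 * L * (real N + 1))" using h by (simp add: d_def)
        moreover have "0 < 8 * L * (real N + 1)" using L by simp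
        ultimately have "h * (8 * L * (real N + 1)) \<le> \<epsilon>" by (simp only: pos_le_divide_eq)
        then show ?thesis by (simp add: algebra_simps)
      qed
      finally have "4 * L * m3 (r s) s - \<epsilon> / 2 \<le> 4 * L * m3 (r s) \<tau>"
        by (simp add: algebra_simps)
      moreover have "\<Lambda> * m3 (r s) s \<le> 4 * L * m3 (r s) s"
        using L nonneg[OF sI] by (intro mult_right_mono) auto
      ultimately have "\<Lambda> * m3 (r s) s + \<Lambda> + \<epsilon> / 2 - 4 * L * m3 (r s) \<tau> \<le> \<Lambda> + \<epsilon>" by linarith
      from mult_right_mono[OF this less_imp_le[OF h(1)]]
      have "(\<Lambda> * m3 (r s) s + \<Lambda> + \<epsilon> / 2) * h - 4 * (L * h) * m3 (r s) \<tau> \<le> (\<Lambda> + \<epsilon>) * h"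
        by (simp add: algebra_simps)
      moreover have "m4 (r s) \<tau> + 4 * (L * h) * m3 (r s) \<tau> \<le> m4 (r \<tau>) \<tau>"
        using conv[OF \<tau>I, of "L * h" "r s"] h L r(2)[of \<tau>] \<tau> s by (simp add: rshift[of \<tau> s] h_def)
      ultimately show ?thesis using 1 by (simp add: h_def)
    qed
    ultimately show "\<exists>d>0. \<forall>\<tau>. t0 \<le> \<tau> \<and> s - d < \<tau> \<and> \<tau> < s \<longrightarrow> m4 (r s) s \<le> m4 (r \<tau>) \<tau> + (\<Lambda> + \<epsilon>) * (s - \<tau>)"
      by blast
  next
    fix s \<epsilon> :: real assume s: "t0 \<le> s" "s < t" and \<epsilon>: "0 < \<epsilon>"
    have sI: "s \<in> I" using s t by auto
    note rs = r[OF s(1) less_imp_le[OF s(2)]]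
    define X where "X = \<Lambda> * m3 (r s) s + \<Lambda> + 1"
    have "X > 0" using \<Lambda> nonneg[OF sI, of "r s"] by (simp add: X_def add_nonneg_pos)
    have "upper_deriv (m4 (r s)) I s < ereal X"
      using up4[OF sI rs] by (rule le_less_trans) (simp add: X_def)
    from upper_deriv_lessD[OF this] obtain d where d: "d > 0"
      "\<And>\<tau>. \<tau> \<in> I \<Longrightarrow> \<tau> \<noteq> s \<Longrightarrow> \<bar>\<tau> - s\<bar> < d \<Longrightarrow> (m4 (r s) \<tau> - m4 (r s) s) / (\<tau> - s) < X" by metis
    have "m4 (r \<tau>) \<tau> \<le> m4 (r s) s + \<epsilon>" if \<tau>: "s < \<tau>" "\<tau> < s + min d (\<epsilon> / X)" "\<tau> \<le> t" for \<tau>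
    proof -
      have \<tau>I: "\<tau> \<in> I" using \<tau> s t by auto
      have "(m4 (r s) \<tau> - m4 (r s) s) / (\<tau> - s) < X" using d(2)[OF \<tau>I] \<tau> by auto
      then have "m4 (r s) \<tau> - m4 (r s) s < X * (\<tau> - s)" using \<tau> by (simp add: pos_divide_less_eq)
      also have "X * (\<tau> - s) \<le> \<epsilon>"
      proof -
        have "\<tau> - s < \<epsilon> / X" using \<tau> by linarith
        then show ?thesis using \<open>X > 0\<close> by (simp add: pos_less_divide_eq mult.commute)
      qed
      finally have "m4 (r s) \<tau> \<le> m4 (r s) s + \<epsilon>" by simp
      moreover have "m4 (r \<tau>) \<tau> \<le> m4 (r s) \<tau>"
      proof -
        have "0 \<le> 4 * (L * (\<tau> - s)) * m3 (r \<tau>) \<tau>" using L \<tau> nonneg[OF \<tau>I] by simp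
        with conv[OF \<tau>I, of "L * (\<tau> - s)" "r \<tau>"] L \<tau> rs(2) show ?thesis by (simp add: rshift[of s \<tau>])
      qed
      ultimately show ?thesis by linarith
    qed
    moreover have "min d (\<epsilon> / X) > 0" using d \<epsilon> \<open>X > 0\<close> by simp
    ultimately show "\<exists>d>0. \<forall>\<tau>. s < \<tau> \<and> \<tau> < s + d \<and> \<tau> \<le> t \<longrightarrow> m4 (r \<tau>) \<tau> \<le> m4 (r s) s + \<epsilon>"
      by blast
  qed
  then show ?thesis by (simp add: r_def L_def)
qed

section \<open>Local mass bounds\<close>

text \<open>With a pointwise bound the velocity term is a multiple of the integral of \<open>bump 3 a r\<close>; with an
  \<open>L\<^sup>2\<close> bound it is a constant. Both fit the form of growth that the barrier argument tolerates.\<close>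
lemma brakke_variation_bump_le:
  fixes a :: "real ^ 'm"
  assumes V: "V \<in> varifolds n U" and U: "open U" "cball a R \<subseteq> U" and r: "0 < r" "r \<le> R\<^sup>2" "0 \<le> R"
    and B: "brakke_variation n U \<B>"
    and u: "(AE x in completion (weight U V). x \<in> cball a R \<longrightarrow> norm (u x) \<le> M) \<or>
      set_integrable (completion (weight U V)) (cball a R) (\<lambda>x. (norm (u x))\<^sup>2) \<and>
      (LINT x:cball a R|completion (weight U V). (norm (u x))\<^sup>2) \<le> M\<^sup>2"
    and \<Lambda>: "8 * real n + (4 * R + R\<^sup>2 / 2) * (1 + M\<^sup>2 * (1 + R ^ 6)) \<le> \<Lambda>"
  shows "\<B> V (bump 4 a r) u \<le> ereal (\<Lambda> * (LINT x|weight U V. bump 3 a r x) + \<Lambda>)"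
proof -
  let ?W = "weight U V"
  define C where "C = 4 * R + R\<^sup>2 / 2"
  have C: "0 \<le> C" using r by (simp add: C_def)
  define I where "I = (LINT x|?W. bump 3 a r x)"
  have I: "0 \<le> I" unfolding I_def by (intro integral_nonneg_AE AE_I2) (simp add: bump_nonneg)
  have bi: "integrable ?W (bump 3 a r)"
    using r by (intro integrable_weight_continuous[OF V U(1) compact_cball U(2)] continuous_bump
        bump_eq_0[where R = R]) auto
  then have bm: "bump 3 a r \<in> borel_measurable ?W" by auto
  have bic: "integrable (completion ?W) (bump 3 a r)"
    using bi bm by (simp add: integrable_completion)
  have pw: "bump 3 a r x * (norm (u x))\<^sup>2 \<le> R ^ 6 * (indicator (cball a R) x *\<^sub>R (norm (u x))\<^sup>2)" for x
  proof (cases "x \<in> cball a R")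
    case True
    have "bump 3 a r x \<le> (R\<^sup>2) ^ 3"
      using bump_le[of r 3 a x] power_mono[of r "R\<^sup>2" 3] r by linarith
    then show ?thesis using True by (simp add: mult_right_mono flip: power_mult)
  next
    case False
    then show ?thesis using bump_eq_0[of 3 r R x a] r by simp
  qed
  have main: "brakke_integral V (bump 4 a r) u H \<le> \<Lambda> * I + \<Lambda>" if adm: "brakke_admissible U V (bump 4 a r) u H" for H
  proof -
    note est = brakke_integral_bump_le[OF V U r adm]
    have "(LINT x|completion ?W. bump 3 a r x * (norm (u x))\<^sup>2) \<le> M\<^sup>2 * I + R ^ 6 * M\<^sup>2"
      using u
    proof
      assume AE: "AE x in completion ?W. x \<in> cball a R \<longrightarrow> norm (u x) \<le> M"
      have "(LINT x|completion ?W. bump 3 a r x * (norm (u x))\<^sup>2) \<le> (LINT x|completion ?W. M\<^sup>2 * bump 3 a r x)"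
      proof (rule integral_mono_AE[OF est(1)])
        show "AE x in completion ?W. bump 3 a r x * (norm (u x))\<^sup>2 \<le> M\<^sup>2 * bump 3 a r x"
          using AE
        proof eventually_elim
          case (elim x)
          show ?case
          proof (cases "x \<in> cball a R")
            case True
            with elim have "(norm (u x))\<^sup>2 \<le> M\<^sup>2" by (intro power_mono) auto
            then show ?thesis using mult_left_mono[OF _ bump_nonneg] by (metis mult.commute)
          next
            case False
            then show ?thesis using bump_eq_0[of 3 r R x a] r by simp
          qed
        qed
      qed (use bic in simp)
      also have "\<dots> = M\<^sup>2 * I" using integral_completion[OF bm] by (simp add: I_def)
      finally show ?thesis by (simp add: add_increasing2)
    next
      assume L2: "set_integrable (completion ?W) (cball a R) (\<lambda>x. (norm (u x))\<^sup>2) \<and>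
        (LINT x:cball a R|completion ?W. (norm (u x))\<^sup>2) \<le> M\<^sup>2"
      have "(LINT x|completion ?W. bump 3 a r x * (norm (u x))\<^sup>2)
          \<le> (LINT x|completion ?W. R ^ 6 * (indicator (cball a R) x *\<^sub>R (norm (u x))\<^sup>2))"
        using L2 pw by (intro integral_mono est(1)) (auto simp: set_integrable_def)
      also have "\<dots> = R ^ 6 * (LINT x:cball a R|completion ?W. (norm (u x))\<^sup>2)"
        by (simp add: set_lebesgue_integral_def)
      also have "\<dots> \<le> R ^ 6 * M\<^sup>2" using L2 r by (intro mult_left_mono) auto
      finally show ?thesis using I by (simp add: add_increasing)
    qed
    from mult_left_mono[OF this C] have "brakke_integral V (bump 4 a r) u H
        \<le> (8 * real n + C) * I + C * (M\<^sup>2 * I + R ^ 6 * M\<^sup>2)"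
      using est(2) by (simp add: C_def I_def algebra_simps)
    also have "\<dots> = (8 * real n + C * (1 + M\<^sup>2)) * I + C * M\<^sup>2 * R ^ 6"
      by (simp add: algebra_simps)
    also have "\<dots> \<le> \<Lambda> * I + \<Lambda>"
    proof (intro add_mono mult_right_mono)
      have "C * (1 + M\<^sup>2) \<le> C * (1 + M\<^sup>2 * (1 + R ^ 6))" "C * (M\<^sup>2 * R ^ 6) \<le> C * (1 + M\<^sup>2 * (1 + R ^ 6))"
        using C r by (auto intro!: mult_left_mono simp: algebra_simps add_increasing)
      then show "8 * real n + C * (1 + M\<^sup>2) \<le> \<Lambda>" "C * M\<^sup>2 * R ^ 6 \<le> \<Lambda>"
        using \<Lambda> unfolding C_def[symmetric] mult.assoc by linarith+
    qed (rule I)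
    finally show ?thesis .
  qed
  have "bump 4 a r \<in> Cc2 U" using r U by (intro bump_in_Cc2[where R = R]) auto
  with B V have "(\<forall>H. brakke_admissible U V (bump 4 a r) u H \<longrightarrow>
        \<B> V (bump 4 a r) u \<le> ereal (brakke_integral V (bump 4 a r) u H)) \<and>
      ((\<nexists>H. brakke_admissible U V (bump 4 a r) u H) \<longrightarrow> \<B> V (bump 4 a r) u = - \<infinity>)"
    unfolding brakke_variation_def by (auto simp: bump_nonneg)
  with main show ?thesis
    unfolding I_def[symmetric] by (metis ereal_less_eq(2) ereal_less_eq(3) order_trans)
qed

text \<open>A common form of the alternative hypotheses on the velocity: one constant for all times, and
  either a pointwise or an \<open>L\<^sup>2\<close> bound.\<close>
lemma velocity_bound:
  fixes u :: "real \<Rightarrow> real ^ 'm \<Rightarrow> real ^ 'm"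
  assumes u: "(\<forall>K \<in> sets borel. compactly_contained K U \<longrightarrow>
            (SUP t\<in>I. Linf_norm_on (completion (weight U (V t))) K (u t)) < \<infinity>) \<or>
         (\<forall>K \<in> sets borel. compactly_contained K U \<longrightarrow>
            (SUP t\<in>I. L2_norm_on (completion (weight U (V t))) K (u t)) < \<infinity>)"
    and K: "compact K" "K \<subseteq> U"
  obtains M where "\<And>t. t \<in> I \<Longrightarrow> (AE x in completion (weight U (V t)). x \<in> K \<longrightarrow> norm (u t x) \<le> M) \<or>
      set_integrable (completion (weight U (V t))) K (\<lambda>x. (norm (u t x))\<^sup>2) \<and>
      (LINT x:K|completion (weight U (V t)). (norm (u t x))\<^sup>2) \<le> M\<^sup>2"
proof -
  have "K \<in> sets borel" "compactly_contained K U"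
    using borel_compact[OF K(1)] K closure_closed[OF compact_imp_closed[OF K(1)]]
    by (simp_all add: compactly_contained_def)
  with u consider
      "(SUP t\<in>I. Linf_norm_on (completion (weight U (V t))) K (u t)) < \<infinity>"
    | "(SUP t\<in>I. L2_norm_on (completion (weight U (V t))) K (u t)) < \<infinity>" by blast
  then show ?thesis
  proof cases
    case 1
    from less_imp_neq[OF this, THEN less_PInf_Ex_of_nat[THEN iffD1]] obtain N :: nat where N: "(SUP t\<in>I. Linf_norm_on (completion (weight U (V t))) K (u t)) < ereal (real N)"
      by blast
    show ?thesis
    proof (rule that, rule disjI1)
      fix t assume "t \<in> I"
      then have *: "Linf_norm_on (completion (weight U (V t))) K (u t) < ereal (real N)"
        using N by (meson SUP_lessD)
      then have "set_borel_measurable (completion (weight U (V t))) K (u t)"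
        by (auto simp: Linf_norm_on_def split: if_splits)
      with * have "Inf {ereal C |C. 0 \<le> C \<and> (AE x in completion (weight U (V t)). x \<in> K \<longrightarrow> norm (u t x) \<le> C)} < ereal (real N)"
        by (simp add: Linf_norm_on_def)
      then obtain C where "C < real N" "AE x in completion (weight U (V t)). x \<in> K \<longrightarrow> norm (u t x) \<le> C"
        by (auto simp: Inf_less_iff)
      from this(2) show "AE x in completion (weight U (V t)). x \<in> K \<longrightarrow> norm (u t x) \<le> real N"
        by eventually_elim (use \<open>C < real N\<close> in auto)
    qed
  next
    case 2
    from less_imp_neq[OF this, THEN less_PInf_Ex_of_nat[THEN iffD1]] obtain N :: nat where N: "(SUP t\<in>I. L2_norm_on (completion (weight U (V t))) K (u t)) < ereal (real N)"
      by blast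
    show ?thesis
    proof (rule that, rule disjI2)
      fix t assume "t \<in> I"
      then have *: "L2_norm_on (completion (weight U (V t))) K (u t) < ereal (real N)"
        using N by (meson SUP_lessD)
      then have sq: "square_integrable_on (completion (weight U (V t))) K (u t)"
        by (auto simp: L2_norm_on_def split: if_splits)
      with * have "sqrt (LINT x:K|completion (weight U (V t)). (norm (u t x))\<^sup>2) < real N"
        by (simp add: L2_norm_on_def)
      then have "(LINT x:K|completion (weight U (V t)). (norm (u t x))\<^sup>2) \<le> (real N)\<^sup>2"
        by (intro sqrt_le_D) simp
      with sq show "set_integrable (completion (weight U (V t))) K (\<lambda>x. (norm (u t x))\<^sup>2) \<and>
          (LINT x:K|completion (weight U (V t)). (norm (u t x))\<^sup>2) \<le> (real N)\<^sup>2"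
        by (simp add: square_integrable_on_def)
    qed
  qed
qed

text \<open>The barrier starts at \<open>t0\<close>, slightly before \<open>s\<close> (or at the initial time), with the full ball.
  Its radius stays above \<open>R / sqrt 2\<close> until time \<open>s + d\<close>, so it controls the concentric ball of half
  the radius, in terms of the finite mass at the single time \<open>t0\<close>.\<close>
lemma ball_mass_bound:
  fixes a :: "real ^ 'm"
  assumes V: "\<And>t. t \<in> {t1..t2} \<Longrightarrow> V t \<in> varifolds n U"
    and U: "open U" "cball a R \<subseteq> U" "0 < R"
    and \<Lambda>: "0 \<le> \<Lambda>"
    and up4: "\<And>r s. s \<in> {t1..t2} \<Longrightarrow> 0 < r \<Longrightarrow> r \<le> R\<^sup>2 \<Longrightarrow>
      upper_deriv (\<lambda>t. LINT x|weight U (V t). bump 4 a r x) {t1..t2} s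
      \<le> ereal (\<Lambda> * (LINT x|weight U (V s). bump 3 a r x) + \<Lambda>)"
    and up3: "\<And>r s. s \<in> {t1..t2} \<Longrightarrow> 0 < r \<Longrightarrow> r \<le> R\<^sup>2 \<Longrightarrow>
      upper_deriv (\<lambda>t. LINT x|weight U (V t). bump 3 a r x) {t1..t2} s < \<infinity>"
    and s: "s \<in> {t1..t2}"
  obtains d M where "d > 0"
    "\<And>t. t \<in> {t1..t2} \<Longrightarrow> \<bar>t - s\<bar> < d \<Longrightarrow> measure (weight U (V t)) (cball a (R / 2)) \<le> M"
proof -
  define d where "d = R\<^sup>2 / (4 * (\<Lambda> + 1))"
  have d: "d > 0" "(\<Lambda> + 1) * (2 * d) = R\<^sup>2 / 2" using U(3) \<Lambda> by (auto simp: d_def field_simps)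
  define t0 where "t0 = max t1 (s - d)"
  define m where "m p r t = (LINT x|weight U (V t). bump p a r x)" for p r t
  define M where "M = (m 4 (R\<^sup>2) t0 + \<Lambda> * (2 * d)) / (R\<^sup>2 / 4) ^ 4"
  have bint: "integrable (weight U (V t)) (bump p a r)" if "t \<in> {t1..t2}" "p \<ge> 1" "r \<le> R\<^sup>2" for t p r
    using that U by (intro integrable_weight_continuous[OF V[OF that(1)] U(1) compact_cball U(2)]
        continuous_bump bump_eq_0[where R = R]) auto
  have "measure (weight U (V t)) (cball a (R / 2)) \<le> M" if t: "t \<in> {t1..t2}" "\<bar>t - s\<bar> < d" for t
  proof -
    have tt: "t0 \<le> t" "{t0..t} \<subseteq> {t1..t2}" "t - t0 \<le> 2 * d" "t0 \<in> {t1..t2}"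
      using t s d by (auto simp: t0_def)
    have Lt: "(\<Lambda> + 1) * (t - t0) \<le> R\<^sup>2 / 2"
      unfolding d(2)[symmetric] using tt \<Lambda> by (intro mult_left_mono) auto
    have "m 4 (R\<^sup>2 - (\<Lambda> + 1) * (t - t0)) t \<le> m 4 (R\<^sup>2) t0 + \<Lambda> * (t - t0)"
    proof (rule barrier_bound[where I = "{t1..t2}" and ?m3.0 = "m 3"])
      fix r h t assume *: "t \<in> {t1..t2}" "0 \<le> h" "r + h \<le> R\<^sup>2"
      have "m 4 r t + 4 * h * m 3 r t = (LINT x|weight U (V t). bump 4 a r x + 4 * h * bump 3 a r x)"
        unfolding m_def using bint[OF *(1), of 4 r] bint[OF *(1), of 3 r] * by simp
      also have "\<dots> \<le> m 4 (r + h) t"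
        unfolding m_def
        using bint[OF *(1), of 4 r] bint[OF *(1), of 3 r] bint[OF *(1), of 4 "r + h"] *
          bump_shift[of h 3 a r]
        by (intro integral_mono) (auto simp: eval_nat_numeral)
      finally show "m 4 r t + 4 * h * m 3 r t \<le> m 4 (r + h) t" .
    next
      show "(\<Lambda> + 1) * (t - t0) < R\<^sup>2" using Lt U(3) zero_less_power[of R 2] by linarith
      show "0 \<le> m 3 r t" for r t
        unfolding m_def by (intro integral_nonneg_AE AE_I2) (simp add: bump_nonneg)
    qed (use tt \<Lambda> up4 up3 in \<open>auto simp: m_def[abs_def]\<close>)
    also have "\<dots> \<le> m 4 (R\<^sup>2) t0 + \<Lambda> * (2 * d)"
      using tt \<Lambda> by (intro add_left_mono mult_left_mono) auto
    finally have mass: "m 4 (R\<^sup>2 - (\<Lambda> + 1) * (t - t0)) t \<le> m 4 (R\<^sup>2) t0 + \<Lambda> * (2 * d)" .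
    let ?r = "R\<^sup>2 - (\<Lambda> + 1) * (t - t0)"
    have rR: "?r \<le> R\<^sup>2" "R\<^sup>2 / 2 \<le> ?r" using tt \<Lambda> Lt by auto
    have low: "(R\<^sup>2 / 4) ^ 4 * indicator (cball a (R / 2)) x \<le> bump 4 a ?r x" for x
    proof (cases "x \<in> cball a (R / 2)")
      case True
      then have "norm (x - a) \<le> R / 2" by (simp add: dist_norm norm_minus_commute)
      then have "(norm (x - a))\<^sup>2 \<le> (R / 2)\<^sup>2" by (intro power_mono) auto
      then have "R\<^sup>2 / 4 \<le> ?r - (norm (x - a))\<^sup>2" using rR by (simp add: power_divide)
      then have "(R\<^sup>2 / 4) ^ 4 \<le> max 0 (?r - (norm (x - a))\<^sup>2) ^ 4"
        by (intro power_mono) (simp_all add: le_max_iff_disj)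
      then show ?thesis using True by (simp add: bump_def)
    qed (auto simp: bump_nonneg)
    have cb: "cball a (R / 2) \<subseteq> U" using U by (auto intro: order_trans)
    have "measure (weight U (V t)) (cball a (R / 2)) * (R\<^sup>2 / 4) ^ 4
        = (LINT x|weight U (V t). (R\<^sup>2 / 4) ^ 4 * indicator (cball a (R / 2)) x)"
      using compact_in_sets_weight[OF U(1) compact_cball cb] emeasure_weight_compact[OF V[OF t(1)] U(1) compact_cball cb]
      by (simp add: space_weight Int_absorb2 cb)
    also have "\<dots> \<le> m 4 ?r t"
      unfolding m_def
      using bint[OF t(1) _ rR(1), of 4] low compact_in_sets_weight[OF U(1) compact_cball cb]
        emeasure_weight_compact[OF V[OF t(1)] U(1) compact_cball cb]
      by (intro integral_mono) auto
    also note mass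
    finally show ?thesis
      using U(3) by (simp add: M_def pos_le_divide_eq)
  qed
  with d(1) show ?thesis by (rule that)
qed

lemma compact_mass_bound:
  fixes U :: "(real ^ 'm) set" and s :: real
  assumes V: "\<And>t. t \<in> I \<Longrightarrow> V t \<in> varifolds n U" and U: "open U"
    and K: "compact K" "K \<subseteq> U"
    and balls: "\<And>a R. 0 < R \<Longrightarrow> cball a R \<subseteq> U \<Longrightarrow>
      \<exists>d>0. \<exists>M. \<forall>t\<in>I. \<bar>t - s\<bar> < d \<longrightarrow> measure (weight U (V t)) (cball a (R / 2)) \<le> M"
  obtains d M where "d > 0" "\<And>t. t \<in> I \<Longrightarrow> \<bar>t - s\<bar> < d \<Longrightarrow> measure (weight U (V t)) K \<le> M"
proof -
  have "\<exists>R>0. cball x R \<subseteq> U" if "x \<in> K" for x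
    using K U that by (meson open_contains_cball subsetD)
  then obtain R where R: "\<And>x. x \<in> K \<Longrightarrow> R x > 0 \<and> cball x (R x) \<subseteq> U" by metis
  have "K \<subseteq> (\<Union>x\<in>K. ball x (R x / 2))" using R by force
  with compactE_image[OF K(1), of K "\<lambda>x. ball x (R x / 2)"]
  obtain C where C: "C \<subseteq> K" "finite C" "K \<subseteq> (\<Union>x\<in>C. ball x (R x / 2))" by auto
  have "\<forall>x\<in>C. \<exists>d M. d > 0 \<and> (\<forall>t\<in>I. \<bar>t - s\<bar> < d \<longrightarrow> measure (weight U (V t)) (cball x (R x / 2)) \<le> M)"
    using balls R C(1) by (meson subsetD)
  then obtain d M where dM: "\<And>x. x \<in> C \<Longrightarrow> d x > (0::real)"
    "\<And>x t. x \<in> C \<Longrightarrow> t \<in> I \<Longrightarrow> \<bar>t - s\<bar> < d x \<Longrightarrow> measure (weight U (V t)) (cball x (R x / 2)) \<le> M x"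
    by metis
  define d0 where "d0 = Min (insert 1 (d ` C))"
  have d0: "d0 > 0" "\<And>x. x \<in> C \<Longrightarrow> d0 \<le> d x"
    using dM(1) C(2) by (auto simp: d0_def)
  have "measure (weight U (V t)) K \<le> (\<Sum>x\<in>C. M x)" if t: "t \<in> I" "\<bar>t - s\<bar> < d0" for t
  proof -
    have cb: "cball x (R x / 2) \<subseteq> U" if "x \<in> C" for x
    proof -
      have "cball x (R x / 2) \<subseteq> cball x (R x)" using R[of x] that C(1) by (intro subset_cball) force
      then show ?thesis using R[of x] that C(1) by blast
    qed
    have fm: "cball x (R x / 2) \<in> fmeasurable (weight U (V t))" if "x \<in> C" for x
      using compact_in_sets_weight[OF U compact_cball cb[OF that]]
        emeasure_weight_compact[OF V[OF t(1)] U compact_cball cb[OF that]]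
      by (intro fmeasurableI)
    have "measure (weight U (V t)) K \<le> measure (weight U (V t)) (\<Union>x\<in>C. cball x (R x / 2))"
    proof (rule measure_mono_fmeasurable)
      show "K \<subseteq> (\<Union>x\<in>C. cball x (R x / 2))" using C(3) ball_subset_cball by blast
      show "K \<in> sets (weight U (V t))" by (rule compact_in_sets_weight[OF U K])
      show "(\<Union>x\<in>C. cball x (R x / 2)) \<in> fmeasurable (weight U (V t))"
        using fm C(2) by (intro fmeasurable.finite_UN)
    qed
    also have "\<dots> \<le> (\<Sum>x\<in>C. measure (weight U (V t)) (cball x (R x / 2)))"
      using fm C(2) by (intro measure_UNION_le) (auto simp: fmeasurableD)
    also have "\<dots> \<le> (\<Sum>x\<in>C. M x)"
      using t d0(2) by (intro sum_mono dM(2)) force+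
    finally show ?thesis .
  qed
  with d0(1) show ?thesis by (rule that)
qed

section \<open>Time-dependent test functions\<close>

text \<open>The difference quotient splits into that of the fixed test function \<open>\<phi> s\<close>, the integral of the
  time derivative \<open>\<psi>\<close>, and the integral of an error \<open>e t\<close> that tends to zero uniformly and lives on
  a fixed compact set. A bound on the mass of that set for times near \<open>s\<close> makes the last part vanish.\<close>
lemma time_dependent_upper_deriv_le:
  fixes U :: "(real ^ 'm) set"
  assumes V: "\<And>t. t \<in> I \<Longrightarrow> V t \<in> varifolds n U" and U: "open U"
    and mass: "\<And>K. compact K \<Longrightarrow> K \<subseteq> U \<Longrightarrow>
      \<exists>d>0. \<exists>M. \<forall>t\<in>I. \<bar>t - s\<bar> < d \<longrightarrow> measure (weight U (V t)) K \<le> M"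
    and s: "s \<in> I" "at s within I \<noteq> bot"
    and \<phi>: "\<phi> \<in> C1_Cc1 I U"
  shows "upper_deriv (\<lambda>t. LINT x|weight U (V t). \<phi> t x) I s
           \<le> upper_deriv (\<lambda>t. LINT x|weight U (V t). \<phi> s x) I s
             + Limsup (at 0 within {\<delta>. s + \<delta> \<in> I})
                 (\<lambda>\<delta>. ereal (LINT x|weight U (V (s + \<delta>)). time_derivative \<phi> I U s x))"
proof -
  from \<phi> obtain K0 \<psi> where \<phi>C: "\<And>t. t \<in> I \<Longrightarrow> \<phi> t \<in> Cc1 U"
    and K0: "compact K0" "K0 \<subseteq> U" "\<And>t. t \<in> I \<Longrightarrow> supp (\<phi> t) \<subseteq> K0"
    and der: "has_Cc1_time_derivative \<phi> \<psi> I U s"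
    using s(1) unfolding C1_Cc1_def by auto
  have td: "time_derivative \<phi> I U s = \<psi>" by (rule time_derivative_eq[OF der \<phi>C s])
  have \<psi>C: "\<psi> \<in> Cc1 U" using der by (simp add: has_Cc1_time_derivative_def)
  define K where "K = K0 \<union> supp \<psi>"
  have K: "compact K" "K \<subseteq> U" using K0 \<psi>C by (auto simp: K_def Cc1_def)
  define e where "e t x = (\<phi> t x - \<phi> s x) / (t - s) - \<psi> x" for t x
  have eC: "e t \<in> Cc1 U" if "t \<in> I" for t
    unfolding e_def using that s by (intro Cc1_diff Cc1_divide \<phi>C \<psi>C)
  have e0: "e t x = 0" if "t \<in> I" "x \<notin> K" for t x
  proof -
    have "x \<notin> supp (\<phi> t)" "x \<notin> supp (\<phi> s)" "x \<notin> supp \<psi>"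
      using K0(3)[OF that(1)] K0(3)[OF s(1)] that(2) by (auto simp: K_def)
    then show ?thesis by (simp add: e_def notin_supp)
  qed
  obtain d M where d: "d > 0" and M: "\<And>t. t \<in> I \<Longrightarrow> \<bar>t - s\<bar> < d \<Longrightarrow> measure (weight U (V t)) K \<le> M"
    using mass[OF K] by blast
  have "((\<lambda>t. LINT x|weight U (V t). e t x) \<longlongrightarrow> 0) (at s within I)"
  proof (rule Lim_null_comparison)
    show "\<forall>\<^sub>F t in at s within I. norm (LINT x|weight U (V t). e t x) \<le> C1_norm (e t) * M"
      unfolding eventually_at dist_real_def
    proof (intro exI[of _ d] conjI ballI impI d)
      fix t assume t: "t \<in> I" "t \<noteq> s \<and> \<bar>t - s\<bar> < d"
      let ?W = "weight U (V t)"
      have Kf: "emeasure ?W K < \<infinity>" "K \<in> sets ?W"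
        using emeasure_weight_compact[OF V[OF t(1)] U K] compact_in_sets_weight[OF U K] by auto
      have c0: "0 \<le> C1_norm (e t)" using abs_le_C1_norm[OF eC[OF t(1)]] abs_ge_zero order_trans by blast
      have "norm (LINT x|?W. e t x) \<le> (LINT x|?W. norm (e t x))" by (rule integral_norm_bound)
      also have "\<dots> \<le> (LINT x|?W. C1_norm (e t) * indicator K x)"
      proof (rule integral_mono)
        show "integrable ?W (\<lambda>x. norm (e t x))"
          using integrable_weight_Cc1[OF V[OF t(1)] U eC[OF t(1)]] by auto
        show "integrable ?W (\<lambda>x. C1_norm (e t) * indicator K x)" using Kf by auto
        show "norm (e t x) \<le> C1_norm (e t) * indicator K x" for x
          using abs_le_C1_norm[OF eC[OF t(1)], of x] e0[OF t(1), of x] by (auto simp: indicator_def)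
      qed
      also have "\<dots> = C1_norm (e t) * measure ?W K"
        using Kf K by (simp add: space_weight Int_absorb2)
      also have "\<dots> \<le> C1_norm (e t) * M" using M[of t] t c0 by (intro mult_left_mono) auto
      finally show "norm (LINT x|?W. e t x) \<le> C1_norm (e t) * M" .
    qed
    have "((\<lambda>t. C1_norm (e t)) \<longlongrightarrow> 0) (at s within I)"
      using der unfolding has_Cc1_time_derivative_def e_def[abs_def] by simp
    from tendsto_mult_left_zero[OF this]
    show "((\<lambda>t. C1_norm (e t) * M) \<longlongrightarrow> 0) (at s within I)" .
  qed
  note lim = Limsup_add_vanishing_le[OF this,
      of "\<lambda>t. ((LINT x|weight U (V t). \<phi> s x) - (LINT x|weight U (V s). \<phi> s x)) / (t - s)"
         "\<lambda>t. LINT x|weight U (V t). \<psi> x"]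
  have quot: "((LINT x|weight U (V t). \<phi> t x) - (LINT x|weight U (V s). \<phi> s x)) / (t - s)
      = ((LINT x|weight U (V t). \<phi> s x) - (LINT x|weight U (V s). \<phi> s x)) / (t - s)
        + (LINT x|weight U (V t). \<psi> x) + (LINT x|weight U (V t). e t x)" if t: "t \<in> I" "t \<noteq> s" for t
  proof -
    note i = integrable_weight_Cc1[OF V[OF t(1)] U]
    have "(LINT x|weight U (V t). e t x)
        = ((LINT x|weight U (V t). \<phi> t x) - (LINT x|weight U (V t). \<phi> s x)) / (t - s) - (LINT x|weight U (V t). \<psi> x)"
      unfolding e_def using i[OF \<phi>C[OF t(1)]] i[OF \<phi>C[OF s(1)]] i[OF \<psi>C] by simp
    then show ?thesis by (simp add: diff_divide_distrib)
  qed
  have "upper_deriv (\<lambda>t. LINT x|weight U (V t). \<phi> t x) I s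
      = Limsup (at s within I) (\<lambda>t. ereal (((LINT x|weight U (V t). \<phi> s x) - (LINT x|weight U (V s). \<phi> s x)) / (t - s)
        + (LINT x|weight U (V t). \<psi> x) + (LINT x|weight U (V t). e t x)))"
    unfolding upper_deriv_def
    by (intro Limsup_eq) (use quot in \<open>auto simp: eventually_at_filter\<close>)
  also note lim
  also have "Limsup (at s within I) (\<lambda>t. ereal (LINT x|weight U (V t). \<psi> x))
      = Limsup (at 0 within {\<delta>. s + \<delta> \<in> I}) (\<lambda>\<delta>. ereal (LINT x|weight U (V (s + \<delta>)). \<psi> x))"
  proof -
    have "at s within I = filtermap (\<lambda>\<delta>. s + \<delta>) (at 0 within {\<delta>. s + \<delta> \<in> I})"
    proof (rule filter_eqI)
      fix P
      have "(\<forall>x\<in>I. x \<noteq> s \<and> dist x s < d \<longrightarrow> P x)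
          \<longleftrightarrow> (\<forall>x\<in>{\<delta>. s + \<delta> \<in> I}. x \<noteq> 0 \<and> dist x 0 < d \<longrightarrow> P (s + x))" for d
      proof (intro iffI ballI impI)
        fix x assume *: "\<forall>x\<in>{\<delta>. s + \<delta> \<in> I}. x \<noteq> 0 \<and> dist x 0 < d \<longrightarrow> P (s + x)"
          and "x \<in> I" "x \<noteq> s \<and> dist x s < d"
        then show "P x" using bspec[OF *, of "x - s"] by (auto simp: dist_real_def)
      qed (auto simp: dist_real_def)
      then show "eventually P (at s within I)
          \<longleftrightarrow> eventually P (filtermap (\<lambda>\<delta>. s + \<delta>) (at 0 within {\<delta>. s + \<delta> \<in> I}))"
        unfolding eventually_filtermap eventually_at by simp
    qed
    then show ?thesis by (simp add: Limsup_filtermap_eq)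
  qed
  finally show ?thesis unfolding td upper_deriv_def by simp
qed

theorem lemma4p4:
  fixes n k :: nat
    and U :: "(real ^ 'm) set"
    and t1 t2 :: real
    and V :: "real \<Rightarrow> ((real ^ 'm) \<times> (real ^ 'm) set) measure"
    and \<B> :: "((real ^ 'm) \<times> (real ^ 'm) set) measure \<Rightarrow> (real ^ 'm \<Rightarrow> real)
              \<Rightarrow> (real ^ 'm \<Rightarrow> real ^ 'm) \<Rightarrow> ereal"
    and u :: "real \<Rightarrow> real ^ 'm \<Rightarrow> real ^ 'm"
  assumes "n \<ge> 1" and "k \<ge> 1" and "CARD('m) = n + k"
    and "open U" and "t1 < t2"
    and "\<And>t. t \<in> {t1..t2} \<Longrightarrow> V t \<in> varifolds n U"
    and "\<And>W \<phi> f. W \<in> varifolds n U \<Longrightarrow> \<phi> \<in> Cc2 U \<Longrightarrow> \<B> W \<phi> f < \<infinity>"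
    and "brakke_variation n U \<B>"
    and "(\<forall>K \<in> sets borel. compactly_contained K U \<longrightarrow>
            (SUP t\<in>{t1..t2}. Linf_norm_on (completion (weight U (V t))) K (u t)) < \<infinity>) \<or>
         (\<forall>K \<in> sets borel. compactly_contained K U \<longrightarrow>
            (SUP t\<in>{t1..t2}. L2_norm_on (completion (weight U (V t))) K (u t)) < \<infinity>)"
    and B1: "\<And>s \<phi>. s \<in> {t1..t2} \<Longrightarrow> \<phi> \<in> Cc2 U \<Longrightarrow> (\<And>x. 0 \<le> \<phi> x) \<Longrightarrow>
           upper_deriv (\<lambda>t. LINT x|weight U (V t). \<phi> x) {t1..t2} s \<le> \<B> (V s) \<phi> (u s)"
  shows "\<forall>s \<in> {t1..t2}. \<forall>\<phi> \<in> C1_Cc1 {t1..t2} U.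
           upper_deriv (\<lambda>t. LINT x|weight U (V t). \<phi> t x) {t1..t2} s
           \<le> upper_deriv (\<lambda>t. LINT x|weight U (V t). \<phi> s x) {t1..t2} s
             + Limsup (at 0 within {\<delta>. s + \<delta> \<in> {t1..t2}})
                 (\<lambda>\<delta>. ereal (LINT x|weight U (V (s + \<delta>)). time_derivative \<phi> {t1..t2} U s x))"
proof (intro ballI)
  fix s \<phi> assume s: "s \<in> {t1..t2}" and \<phi>: "\<phi> \<in> C1_Cc1 {t1..t2} U"
  have ball: "\<exists>d>0. \<exists>M. \<forall>t\<in>{t1..t2}. \<bar>t - s\<bar> < d \<longrightarrow> measure (weight U (V t)) (cball a (R / 2)) \<le> M"
    if R: "0 < R" and aR: "cball a R \<subseteq> U" for a R
  proof -
    obtain M where M: "\<And>t. t \<in> {t1..t2} \<Longrightarrow>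
        (AE x in completion (weight U (V t)). x \<in> cball a R \<longrightarrow> norm (u t x) \<le> M) \<or>
        set_integrable (completion (weight U (V t))) (cball a R) (\<lambda>x. (norm (u t x))\<^sup>2) \<and>
        (LINT x:cball a R|completion (weight U (V t)). (norm (u t x))\<^sup>2) \<le> M\<^sup>2"
      using velocity_bound[OF assms(9) compact_cball aR] by blast
    define \<Lambda> where "\<Lambda> = 8 * real n + (4 * R + R\<^sup>2 / 2) * (1 + M\<^sup>2 * (1 + R ^ 6))"
    have \<Lambda>: "0 \<le> \<Lambda>" using R by (simp add: \<Lambda>_def)
    have up: "upper_deriv (\<lambda>t. LINT x|weight U (V t). bump p a r x) {t1..t2} \<sigma> \<le> \<B> (V \<sigma>) (bump p a r) (u \<sigma>)"
      "bump p a r \<in> Cc2 U" if "\<sigma> \<in> {t1..t2}" "r \<le> R\<^sup>2" "p \<ge> 3" for p r \<sigma>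
      using that R aR bump_in_Cc2[of p r R a U] by (auto intro!: B1 simp: bump_nonneg)
    have up4: "upper_deriv (\<lambda>t. LINT x|weight U (V t). bump 4 a r x) {t1..t2} \<sigma>
        \<le> ereal (\<Lambda> * (LINT x|weight U (V \<sigma>). bump 3 a r x) + \<Lambda>)"
      if "\<sigma> \<in> {t1..t2}" "0 < r" "r \<le> R\<^sup>2" for r \<sigma>
    proof (rule order_trans[OF up(1)])
      show "\<B> (V \<sigma>) (bump 4 a r) (u \<sigma>) \<le> ereal (\<Lambda> * (LINT x|weight U (V \<sigma>). bump 3 a r x) + \<Lambda>)"
        using R
        by (intro brakke_variation_bump_le[OF assms(6)[OF that(1)] assms(4) aR that(2,3) _ assms(8) M[OF that(1)]])
          (auto simp: \<Lambda>_def)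
    qed (use that in auto)
    have up3: "upper_deriv (\<lambda>t. LINT x|weight U (V t). bump 3 a r x) {t1..t2} \<sigma> < \<infinity>"
      if "\<sigma> \<in> {t1..t2}" "0 < r" "r \<le> R\<^sup>2" for r \<sigma>
      using up[OF that(1,3), of 3] assms(7)[OF assms(6)[OF that(1)]] by (auto intro: le_less_trans)
    show ?thesis
      by (rule ball_mass_bound[OF assms(6) assms(4) aR R \<Lambda> up4 up3 s]) blast+
  qed
  have mass: "\<exists>d>0. \<exists>M. \<forall>t\<in>{t1..t2}. \<bar>t - s\<bar> < d \<longrightarrow> measure (weight U (V t)) K \<le> M"
    if K: "compact K" "K \<subseteq> U" for K
  proof -
    show ?thesis
      by (rule compact_mass_bound[OF assms(6) assms(4) K ball]) blast+
  qed
  have "at s within {t1..t2} \<noteq> bot"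
    using s assms(5) islimpt_Icc[of t1 t2 s] by (simp add: trivial_limit_within)
  then show "upper_deriv (\<lambda>t. LINT x|weight U (V t). \<phi> t x) {t1..t2} s
           \<le> upper_deriv (\<lambda>t. LINT x|weight U (V t). \<phi> s x) {t1..t2} s
             + Limsup (at 0 within {\<delta>. s + \<delta> \<in> {t1..t2}})
                 (\<lambda>\<delta>. ereal (LINT x|weight U (V (s + \<delta>)). time_derivative \<phi> {t1..t2} U s x))"
    by (intro time_dependent_upper_deriv_le[OF assms(6) assms(4) mass s _ \<phi>])
qed

end
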